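(* Let $(X,\delta)$ be a quasi-metric space and $\mathcal{Q}$ a countable subset dense with respect to $\tau_{\delta^*}$, with total numbering $\beta:\mathbb{N}\to\mathcal{Q}$, such that $(X,\delta)$ is computable. Then $(X_c,\tau_\delta,\tau_{\delta^c})$, with numbering $x^c$, is a bi-effective bi-topological space that is effectively pairwise regular.
   Context: Computability conventions: computable pairing $\langle\cdot,\cdot\rangle$ with $\langle a_1,\dots,a_n\rangle=\langle\langle a_1,\dots,a_{n-1}\rangle,a_n\rangle$; Gödel numbering $\varphi$, $W_i=\mathrm{dom}(\varphi_i)$; $P^{(n)}$ partial computable $n$-ary functions; a numbering of $S$ is a partial surjection $\nu:\mathbb{N}\rightharpoonup S$. Quasi-metric: $\delta:X\times X\to[0,\infty)$ with $\delta(x,x)=0$, triangle inequality, $\delta(x,y)=\delta(y,x)=0\Rightarrow x=y$; $\delta^c(x,y)=\delta(y,x)$, $\delta^*=\max(\delta,\delta^c)$; $B_\rho(x,r)=\{y:\rho(x,y)<r\}$, $\tau_\rho$ the generated topology. $(X,\delta)$ is computable if both $\{\langle a,b,c,e\rangle:\delta(\beta_a,\beta_b)<c\cdot2^{-e}\}$ and $\{\langle a,b,c,e\rangle:\delta(\beta_a,\beta_b)>c\cdot2^{-e}\}$ are c.e. A point $y\in X$ is computable if $\{\langle a,b,e\rangle:\delta(\beta_a,y)<2^{-e}\text{ and }\delta(y,\beta_b)<2^{-e}\}$ is c.e.; $X_c$ is the set of computable points and $x^c_i=y$ iff $W_i$ equals that set for $y$ (undefined otherwise). Bases on $X_c$: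 $B^{\tau_\delta}_{\langle i,m\rangle}=B_\delta(\beta_i,2^{-m})\cap X_c$, $\langle i,m\rangle\prec_{B^{\tau_\delta}}\langle j,n\rangle$ iff $\delta(\beta_j,\beta_i)+2^{-m}<2^{-n}$; $B^{\tau_{\delta^c}}_{\langle i,m\rangle}=B_{\delta^c}(\beta_i,2^{-m})\cap X_c$, $\langle i,m\rangle\prec_{B^{\tau_{\delta^c}}}\langle j,n\rangle$ iff $\delta^c(\beta_j,\beta_i)+2^{-m}<2^{-n}$. A space $(T,\tau)$ with numbering $x$, total basis numbering $B$ and strong inclusion $\prec_B$ is effective if there is $sb\in P^{(3)}$ such that for $i\in\mathrm{dom}(x)$ and $m,n$ with $x_i\in B_m\cap B_n$: $sb(i,m,n)$ defined, $x_i\in B_{sb(i,m,n)}$, $sb(i,m,n)\prec_B m$ and $\prec_B n$. A bi-topological space $(T,\tau,\sigma)$ is bi-effective if $(T,\tau)$ and $(T,\sigma)$ are both effective. For a topology with basis numbering $B$, Lacombe sets are $L_n=\bigcup\{B_a:a\in W_n\}$ if $W_n\subseteq\mathrm{dom}(B)$ (undefined otherwise). $\tau$ is effectively regular with respect to $\sigma$ (bases numbered $B^\tau,B^\sigma$, Lacombe numbering $L^\sigma$ of $\sigma$) if there are $s,t\in P^{(2)}$ such that for all $i\in\mathrm{dom}(x)$, $m\in\mathrm{dom}(B^\tau)$ with $x_i\in B^\tau_m$: $s(i,m)\in\mathrm{dom}(B^\tau)$ and $t(i,m)\in\mathrm{dom}(L^\sigma)$ are defined, $x_i\in B^\tau_{s(i,m)}\subseteq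 B^\tau_m$, $T\setminus B^\tau_m\subseteq L^\sigma_{t(i,m)}$, and $B^\tau_{s(i,m)}\cap L^\sigma_{t(i,m)}=\emptyset$. The space is effectively pairwise regular if $\tau$ is effectively regular w.r.t. $\sigma$ and vice versa. *)

theory Defs
  imports "HOL-Analysis.Analysis" "HOL-Library.Nat_Bijection"
begin

section \<open>Partial computable functions\<close>

text \<open>Kleene's schemes. The recursion variable of \<open>PrimRec\<close> and the search variable of
  \<open>Mu\<close> come first in the argument list. Programs carry no arity: a program applied to an
  argument list of unsuitable length may simply have no value.\<close>

datatype recf =
    Zero
  | Succ
  | Proj nat
  | Comp recf "recf list"
  | PrimRec recf recf
  | Mu recf

inductive recf_eval :: "recf \<Rightarrow> nat list \<Rightarrow> nat \<Rightarrow> bool" where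
  Zero: "recf_eval Zero xs 0"
| Succ: "recf_eval Succ [x] (Suc x)"
| Proj: "i < length xs \<Longrightarrow> recf_eval (Proj i) xs (xs ! i)"
| Comp: "list_all2 (\<lambda>g z. recf_eval g xs z) gs zs \<Longrightarrow> recf_eval f zs y
    \<Longrightarrow> recf_eval (Comp f gs) xs y"
| PrimRec_0: "recf_eval f xs y \<Longrightarrow> recf_eval (PrimRec f g) (0 # xs) y"
| PrimRec_Suc: "recf_eval (PrimRec f g) (n # xs) z \<Longrightarrow> recf_eval g (n # z # xs) y
    \<Longrightarrow> recf_eval (PrimRec f g) (Suc n # xs) y"
| Mu: "recf_eval f (n # xs) 0 \<Longrightarrow> (\<forall>m<n. \<exists>y. 0 < y \<and> recf_eval f (m # xs) y)
    \<Longrightarrow> recf_eval (Mu f) xs n"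

text \<open>Membership in the class of \<open>n\<close>-ary partial computable functions; only the values on lists
  of length \<open>n\<close> matter.\<close>

definition partial_computable :: "nat \<Rightarrow> (nat list \<Rightarrow> nat option) \<Rightarrow> bool" where
  "partial_computable n f \<longleftrightarrow>
     (\<exists>r. \<forall>xs y. length xs = n \<longrightarrow> (f xs = Some y \<longleftrightarrow> recf_eval r xs y))"

definition partial_computable1 :: "(nat \<Rightarrow> nat option) \<Rightarrow> bool" where
  "partial_computable1 f \<longleftrightarrow> partial_computable 1 (\<lambda>xs. f (xs ! 0))"

definition partial_computable2 :: "(nat \<Rightarrow> nat \<Rightarrow> nat option) \<Rightarrow> bool" where
  "partial_computable2 f \<longleftrightarrow> partial_computable 2 (\<lambda>xs. f (xs ! 0) (xs ! 1))"

definition partial_computable3 :: "(nat \<Rightarrow> nat \<Rightarrow> nat \<Rightarrow> nat option) \<Rightarrow> bool" where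
  "partial_computable3 f \<longleftrightarrow> partial_computable 3 (\<lambda>xs. f (xs ! 0) (xs ! 1) (xs ! 2))"

definition ce_set :: "nat set \<Rightarrow> bool" where
  "ce_set A \<longleftrightarrow> (\<exists>f. partial_computable1 f \<and> dom f = A)"

text \<open>A Goedel numbering of the unary partial computable functions, in the sense of Rogers:
  its universal function is partial computable, and every computable sequence of partial
  computable functions is uniformly reducible to it. Surjectivity onto the unary partial
  computable functions is the special case of a constant sequence.\<close>

definition goedel_numbering :: "(nat \<Rightarrow> nat \<Rightarrow> nat option) \<Rightarrow> bool" where
  "goedel_numbering \<phi> \<longleftrightarrow>
     partial_computable2 \<phi> \<and>
     (\<forall>f. partial_computable2 f \<longrightarrow>
        (\<exists>h. partial_computable1 (\<lambda>i. Some (h i)) \<and> (\<forall>i. \<phi> (h i) = f i)))"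

definition W :: "(nat \<Rightarrow> nat \<Rightarrow> nat option) \<Rightarrow> nat \<Rightarrow> nat set" where
  "W \<phi> i = dom (\<phi> i)"

abbreviation pair :: "nat \<Rightarrow> nat \<Rightarrow> nat" where
  "pair a b \<equiv> prod_encode (a, b)"

abbreviation triple :: "nat \<Rightarrow> nat \<Rightarrow> nat \<Rightarrow> nat" where
  "triple a b c \<equiv> pair (pair a b) c"

abbreviation quadruple :: "nat \<Rightarrow> nat \<Rightarrow> nat \<Rightarrow> nat \<Rightarrow> nat" where
  "quadruple a b c e \<equiv> pair (triple a b c) e"


section \<open>Effective spaces\<close>

text \<open>A numbering of \<open>S\<close> is a partial surjection from the naturals onto \<open>S\<close>.\<close>

definition numbering_of :: "(nat \<Rightarrow> 's option) \<Rightarrow> 's set \<Rightarrow> bool" where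
  "numbering_of \<nu> S \<longleftrightarrow> ran \<nu> = S"

definition total_basis_numbering :: "'a topology \<Rightarrow> (nat \<Rightarrow> 'a set) \<Rightarrow> bool" where
  "total_basis_numbering \<tau> B \<longleftrightarrow> openin \<tau> = arbitrary union_of (\<lambda>U. U \<in> range B)"

definition strong_inclusion :: "(nat \<Rightarrow> 'a set) \<Rightarrow> (nat \<Rightarrow> nat \<Rightarrow> bool) \<Rightarrow> bool" where
  "strong_inclusion B prec \<longleftrightarrow> transp prec \<and> (\<forall>m n. prec m n \<longrightarrow> B m \<subseteq> B n)"

definition effective_space ::
  "'a topology \<Rightarrow> (nat \<Rightarrow> 'a option) \<Rightarrow> (nat \<Rightarrow> 'a set) \<Rightarrow> (nat \<Rightarrow> nat \<Rightarrow> bool) \<Rightarrow> bool" where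
  "effective_space \<tau> x B prec \<longleftrightarrow>
     numbering_of x (topspace \<tau>) \<and>
     total_basis_numbering \<tau> B \<and>
     strong_inclusion B prec \<and>
     (\<exists>sb. partial_computable3 sb \<and>
        (\<forall>i y m n. x i = Some y \<and> y \<in> B m \<inter> B n \<longrightarrow>
           (\<exists>k. sb i m n = Some k \<and> y \<in> B k \<and> prec k m \<and> prec k n)))"

definition bi_effective_space ::
  "'a topology \<Rightarrow> 'a topology \<Rightarrow> (nat \<Rightarrow> 'a option) \<Rightarrow>
   (nat \<Rightarrow> 'a set) \<Rightarrow> (nat \<Rightarrow> nat \<Rightarrow> bool) \<Rightarrow> (nat \<Rightarrow> 'a set) \<Rightarrow> (nat \<Rightarrow> nat \<Rightarrow> bool) \<Rightarrow> bool" where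
  "bi_effective_space \<tau> \<sigma> x B\<tau> prec\<tau> B\<sigma> prec\<sigma> \<longleftrightarrow>
     topspace \<tau> = topspace \<sigma> \<and>
     effective_space \<tau> x B\<tau> prec\<tau> \<and>
     effective_space \<sigma> x B\<sigma> prec\<sigma>"

text \<open>Basis numberings are total, so every \<open>W\<^sub>n\<close> is contained in their domain and the Lacombe
  numbering is total as well.\<close>

definition lacombe :: "(nat \<Rightarrow> nat \<Rightarrow> nat option) \<Rightarrow> (nat \<Rightarrow> 'a set) \<Rightarrow> nat \<Rightarrow> 'a set" where
  "lacombe \<phi> B n = (\<Union>a\<in>W \<phi> n. B a)"

text \<open>Effective regularity of \<open>\<tau>\<close> with respect to \<open>\<sigma>\<close>; the topology \<open>\<sigma>\<close> enters only through
  its basis numbering.\<close>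

definition effectively_regular_wrt ::
  "(nat \<Rightarrow> nat \<Rightarrow> nat option) \<Rightarrow> 'a set \<Rightarrow> (nat \<Rightarrow> 'a option) \<Rightarrow>
   (nat \<Rightarrow> 'a set) \<Rightarrow> (nat \<Rightarrow> 'a set) \<Rightarrow> bool" where
  "effectively_regular_wrt \<phi> T x B\<tau> B\<sigma> \<longleftrightarrow>
     (\<exists>s t. partial_computable2 s \<and> partial_computable2 t \<and>
        (\<forall>i y m. x i = Some y \<and> y \<in> B\<tau> m \<longrightarrow>
           (\<exists>k l. s i m = Some k \<and> t i m = Some l \<and>
              y \<in> B\<tau> k \<and> B\<tau> k \<subseteq> B\<tau> m \<and>
              T - B\<tau> m \<subseteq> lacombe \<phi> B\<sigma> l \<and>
              B\<tau> k \<inter> lacombe \<phi> B\<sigma> l = {})))"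

definition effectively_pairwise_regular ::
  "(nat \<Rightarrow> nat \<Rightarrow> nat option) \<Rightarrow> 'a set \<Rightarrow> (nat \<Rightarrow> 'a option) \<Rightarrow>
   (nat \<Rightarrow> 'a set) \<Rightarrow> (nat \<Rightarrow> 'a set) \<Rightarrow> bool" where
  "effectively_pairwise_regular \<phi> T x B\<tau> B\<sigma> \<longleftrightarrow>
     effectively_regular_wrt \<phi> T x B\<tau> B\<sigma> \<and>
     effectively_regular_wrt \<phi> T x B\<sigma> B\<tau>"


section \<open>Quasi-metric spaces\<close>

locale quasi_metric_space =
  fixes X :: "'a set" and \<delta> :: "'a \<Rightarrow> 'a \<Rightarrow> real"
  assumes nonneg: "\<lbrakk>x \<in> X; y \<in> X\<rbrakk> \<Longrightarrow> 0 \<le> \<delta> x y"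
    and refl: "x \<in> X \<Longrightarrow> \<delta> x x = 0"
    and triangle: "\<lbrakk>x \<in> X; y \<in> X; z \<in> X\<rbrakk> \<Longrightarrow> \<delta> x z \<le> \<delta> x y + \<delta> y z"
    and zero_imp_eq: "\<lbrakk>x \<in> X; y \<in> X; \<delta> x y = 0; \<delta> y x = 0\<rbrakk> \<Longrightarrow> x = y"

definition conj_dist :: "('a \<Rightarrow> 'a \<Rightarrow> real) \<Rightarrow> 'a \<Rightarrow> 'a \<Rightarrow> real" where
  "conj_dist \<delta> x y = \<delta> y x"

definition sym_dist :: "('a \<Rightarrow> 'a \<Rightarrow> real) \<Rightarrow> 'a \<Rightarrow> 'a \<Rightarrow> real" where
  "sym_dist \<delta> x y = max (\<delta> x y) (conj_dist \<delta> x y)"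

definition qball :: "'a set \<Rightarrow> ('a \<Rightarrow> 'a \<Rightarrow> real) \<Rightarrow> 'a \<Rightarrow> real \<Rightarrow> 'a set" where
  "qball X \<rho> x r = {y \<in> X. \<rho> x y < r}"

definition qtopology :: "'a set \<Rightarrow> ('a \<Rightarrow> 'a \<Rightarrow> real) \<Rightarrow> 'a topology" where
  "qtopology X \<rho> = topology_generated_by {qball X \<rho> x r | x r. x \<in> X \<and> 0 < r}"

definition computable_quasi_metric :: "('a \<Rightarrow> 'a \<Rightarrow> real) \<Rightarrow> (nat \<Rightarrow> 'a) \<Rightarrow> bool" where
  "computable_quasi_metric \<delta> \<beta> \<longleftrightarrow>
     ce_set {quadruple a b c e | a b c e. \<delta> (\<beta> a) (\<beta> b) < real c / 2 ^ e} \<and>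
     ce_set {quadruple a b c e | a b c e. \<delta> (\<beta> a) (\<beta> b) > real c / 2 ^ e}"

definition approximations :: "('a \<Rightarrow> 'a \<Rightarrow> real) \<Rightarrow> (nat \<Rightarrow> 'a) \<Rightarrow> 'a \<Rightarrow> nat set" where
  "approximations \<delta> \<beta> y =
     {triple a b e | a b e. \<delta> (\<beta> a) y < 1 / 2 ^ e \<and> \<delta> y (\<beta> b) < 1 / 2 ^ e}"

definition computable_points :: "'a set \<Rightarrow> ('a \<Rightarrow> 'a \<Rightarrow> real) \<Rightarrow> (nat \<Rightarrow> 'a) \<Rightarrow> 'a set" where
  "computable_points X \<delta> \<beta> = {y \<in> X. ce_set (approximations \<delta> \<beta> y)}"

text \<open>When the range of \<open>\<beta>\<close> is dense for the symmetrised distance, a point is determined by its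
  approximations, so the description below denotes the unique point with \<open>W\<^sub>i\<close> as
  its set of approximations whenever there is such a point.\<close>

definition point_numbering ::
  "(nat \<Rightarrow> nat \<Rightarrow> nat option) \<Rightarrow> 'a set \<Rightarrow> ('a \<Rightarrow> 'a \<Rightarrow> real) \<Rightarrow> (nat \<Rightarrow> 'a) \<Rightarrow> nat \<Rightarrow> 'a option" where
  "point_numbering \<phi> X \<delta> \<beta> i =
     (if \<exists>y\<in>computable_points X \<delta> \<beta>. W \<phi> i = approximations \<delta> \<beta> y
      then Some (THE y. y \<in> computable_points X \<delta> \<beta> \<and> W \<phi> i = approximations \<delta> \<beta> y)
      else None)"

text \<open>The basis and its strong inclusion on a subset \<open>T\<close>, for an arbitrary distance \<open>\<rho>\<close>; both
  \<open>\<delta>\<close> and its conjugate are instances.\<close>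

definition ball_basis ::
  "'a set \<Rightarrow> ('a \<Rightarrow> 'a \<Rightarrow> real) \<Rightarrow> (nat \<Rightarrow> 'a) \<Rightarrow> 'a set \<Rightarrow> nat \<Rightarrow> 'a set" where
  "ball_basis X \<rho> \<beta> T k = (case prod_decode k of (i, m) \<Rightarrow> qball X \<rho> (\<beta> i) (1 / 2 ^ m) \<inter> T)"

definition ball_prec :: "('a \<Rightarrow> 'a \<Rightarrow> real) \<Rightarrow> (nat \<Rightarrow> 'a) \<Rightarrow> nat \<Rightarrow> nat \<Rightarrow> bool" where
  "ball_prec \<rho> \<beta> k l =
     (case prod_decode k of (i, m) \<Rightarrow> case prod_decode l of (j, n) \<Rightarrow>
        \<rho> (\<beta> j) (\<beta> i) + 1 / 2 ^ m < 1 / 2 ^ n)"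

end

theory Submission
  imports Defs
begin

text \<open>Strong inclusion of balls is semidecidable, and since \<open>W\<^sub>i\<close> lists the \<open>\<delta>\<^sup>*\<close>-approximations of
  the point \<open>x\<^sub>i\<close>, so is the relation that a ball \<open>(a, r)\<close> with \<open>\<delta>\<^sup>*(\<beta>\<^sub>a, x\<^sub>i) < 2\<^sup>-\<^sup>r\<close> is strongly
  included in given balls. By density such a ball exists around every point of the given balls, and
  an unbounded search finds it; this yields both \<open>sb\<close> and the function \<open>s\<close> of effective regularity.
  The exterior of the found ball is listed by the conjugate balls that \<open>\<delta>\<close>-distances of centres
  prove to be disjoint from it. Nothing in this distinguishes \<open>\<delta>\<close> from its conjugate. The search over
  semidecidable relations needs a step-bounded evaluation of programs, which can be defined by
  recursion on the program without coding programs as numbers.\<close>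

section \<open>Computable functions on tuples\<close>

text \<open>Rule induction; programs therefore denote partial functions. In the case
  \<open>Mu\<close>, the smaller of two different results would carry both the value 0 and a
  positive value.\<close>

lemma recf_eval_deterministic: "recf_eval r xs y \<Longrightarrow> recf_eval r xs z \<Longrightarrow> y = z"
proof (induction r xs y arbitrary: z rule: recf_eval.induct)
  case (Zero xs)
  then show ?case by (cases rule: recf_eval.cases) auto
next
  case (Succ x)
  then show ?case by (cases rule: recf_eval.cases) auto
next
  case (Proj i xs)
  from Proj.prems show ?case by (cases rule: recf_eval.cases) auto
next
  case (Comp xs gs zs f y)
  from Comp.prems obtain zs' where zs': "list_all2 (\<lambda>g z. recf_eval g xs z) gs zs'" "recf_eval f zs' z"
    by (cases rule: recf_eval.cases) auto
  have "zs = zs'"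
    using Comp.IH(1) zs'(1) by (auto simp: list_all2_conv_all_nth intro!: nth_equalityI)
  then show ?case using Comp.IH(2) zs'(2) by blast
next
  case (PrimRec_0 f xs y g)
  from PrimRec_0.prems show ?case
    by (cases rule: recf_eval.cases) (auto intro: PrimRec_0.IH)
next
  case (PrimRec_Suc f g n xs w y)
  from PrimRec_Suc.prems show ?case
    by (cases rule: recf_eval.cases) (use PrimRec_Suc.IH in blast)+
next
  case (Mu f n xs)
  from Mu.prems have z: "recf_eval f (z # xs) 0" "\<forall>m<z. \<exists>y>0. recf_eval f (m # xs) y"
    by (cases rule: recf_eval.cases; auto)+
  show ?case
  proof (cases n z rule: linorder_cases)
    case less
    then show ?thesis using z(2) Mu.IH(1) by fastforce
  next
    case greater
    then show ?thesis using z(1) Mu.IH(2) by fastforce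
  qed
qed

definition run :: "recf \<Rightarrow> nat list \<Rightarrow> nat option" where
  "run r xs = (if \<exists>y. recf_eval r xs y then Some (THE y. recf_eval r xs y) else None)"

lemma run_eq_Some_iff: "run r xs = Some y \<longleftrightarrow> recf_eval r xs y"
  using recf_eval_deterministic
  by (auto simp: run_def intro: theI2 the_equality)

lemma partial_computable_iff:
  "partial_computable n f \<longleftrightarrow> (\<exists>r. \<forall>xs. length xs = n \<longrightarrow> f xs = run r xs)"
proof -
  have "f xs = run r xs \<longleftrightarrow> (\<forall>y. f xs = Some y \<longleftrightarrow> recf_eval r xs y)" for r xs
    unfolding run_eq_Some_iff[symmetric] by (metis not_None_eq)
  then show ?thesis
    unfolding partial_computable_def by metis
qed

section \<open>Total computable functions and tuples of them\<close>

definition computable :: "nat \<Rightarrow> (nat list \<Rightarrow> nat) \<Rightarrow> bool" where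
  "computable n f \<longleftrightarrow> (\<exists>r. \<forall>xs. length xs = n \<longrightarrow> recf_eval r xs (f xs))"

text \<open>One program per component, the form that \<open>Comp\<close> consumes;
  \<open>list_all2\<close> also forces \<open>L xs\<close> to have length \<open>m\<close>.\<close>

definition computable_list :: "nat \<Rightarrow> nat \<Rightarrow> (nat list \<Rightarrow> nat list) \<Rightarrow> bool" where
  "computable_list n m L \<longleftrightarrow>
     (\<exists>rs. length rs = m \<and> (\<forall>xs. length xs = n \<longrightarrow> list_all2 (\<lambda>r z. recf_eval r xs z) rs (L xs)))"

lemma computable_cong:
  assumes "computable n f" and "\<And>xs. length xs = n \<Longrightarrow> g xs = f xs"
  shows "computable n g"
  using assms unfolding computable_def by auto

lemma computable_list_id: "computable_list n n (\<lambda>xs. xs)"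
  unfolding computable_list_def
  by (rule exI[of _ "map Proj [0..<n]"]) (auto simp: list_all2_conv_all_nth intro: recf_eval.Proj)

lemma computable_list_Nil: "computable_list n 0 (\<lambda>xs. [])"
  unfolding computable_list_def by auto

lemma computable_list_Cons:
  assumes "computable n f" and "computable_list n m L"
  shows "computable_list n (Suc m) (\<lambda>xs. f xs # L xs)"
proof -
  obtain r rs where "\<forall>xs. length xs = n \<longrightarrow> recf_eval r xs (f xs)" and "length rs = m"
    and "\<forall>xs. length xs = n \<longrightarrow> list_all2 (\<lambda>r z. recf_eval r xs z) rs (L xs)"
    using assms unfolding computable_def computable_list_def by blast
  then show ?thesis
    unfolding computable_list_def by (intro exI[of _ "r # rs"]) auto
qed

lemma computable_list_tl:
  assumes "computable_list n (Suc m) L"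
  shows "computable_list n m (\<lambda>xs. tl (L xs))"
proof -
  obtain rs where rs: "length rs = Suc m"
    "\<And>xs. length xs = n \<Longrightarrow> list_all2 (\<lambda>r z. recf_eval r xs z) rs (L xs)"
    using assms unfolding computable_list_def by blast
  have "list_all2 (\<lambda>r z. recf_eval r xs z) (tl rs) (tl (L xs))" if "length xs = n" for xs
    using rs(1) rs(2)[OF that] by (cases rs; cases "L xs") auto
  then show ?thesis
    unfolding computable_list_def using rs(1) by (intro exI[of _ "tl rs"]) auto
qed

lemma computable_nth:
  assumes "computable_list n m L" and "i < m"
  shows "computable n (\<lambda>xs. L xs ! i)"
  using assms unfolding computable_list_def computable_def list_all2_conv_all_nth by blast

lemma computable_compose:
  assumes "computable m f" and "computable_list n m L"
  shows "computable n (\<lambda>xs. f (L xs))"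
proof -
  obtain r rs where r: "\<And>xs. length xs = m \<Longrightarrow> recf_eval r xs (f xs)" and rs: "length rs = m"
    "\<And>xs. length xs = n \<Longrightarrow> list_all2 (\<lambda>r z. recf_eval r xs z) rs (L xs)"
    using assms unfolding computable_def computable_list_def by blast
  then have "recf_eval (Comp r rs) xs (f (L xs))" if "length xs = n" for xs
    using that by (metis recf_eval.Comp list_all2_lengthD)
  then show ?thesis unfolding computable_def by blast
qed

lemma computable_compose1:
  assumes "computable 1 (\<lambda>ys. f (ys ! 0))" and "computable n a"
  shows "computable n (\<lambda>xs. f (a xs))"
  using computable_compose[OF assms(1), of n "\<lambda>xs. [a xs]"] assms(2)
  by (simp add: computable_list_Cons computable_list_Nil)

lemma computable_proj: "i < n \<Longrightarrow> computable n (\<lambda>xs. xs ! i)"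
  by (rule computable_nth[OF computable_list_id])

lemma computable_proj_tl: "Suc i < n \<Longrightarrow> computable n (\<lambda>xs. tl xs ! i)"
  by (rule computable_cong[OF computable_proj, of "Suc i"]) (auto simp: nth_tl)

lemma computable_proj_tl_tl: "Suc (Suc i) < n \<Longrightarrow> computable n (\<lambda>xs. tl (tl xs) ! i)"
  by (rule computable_cong[OF computable_proj, of "Suc (Suc i)"]) (auto simp: nth_tl)

lemma computable_shift: "computable n f \<Longrightarrow> computable (Suc n) (\<lambda>xs. f (tl xs))"
  by (erule computable_compose) (intro computable_list_tl computable_list_id)

section \<open>Primitive recursion and arithmetic\<close>

lemma computable_Suc:
  assumes "computable n f"
  shows "computable n (\<lambda>xs. Suc (f xs))"
proof -
  have "recf_eval Succ xs (Suc (xs ! 0))" if "length xs = 1" for xs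
    using that by (auto simp: length_Suc_conv intro: recf_eval.Succ)
  then have "computable 1 (\<lambda>ys. Suc (ys ! 0))" unfolding computable_def by blast
  then show ?thesis using assms by (rule computable_compose1)
qed

lemma computable_const: "computable n (\<lambda>xs. c)"
proof (induction c)
  case 0
  show ?case unfolding computable_def using recf_eval.Zero by blast
qed (rule computable_Suc)

text \<open>The body \<open>h\<close> sees the counter as argument 0, the previous value as argument
  1 and the parameters as the rest, as \<open>PrimRec\<close> supplies them. Any function written
  with \<open>rec_nat\<close> can then be handled by introduction rules.\<close>

lemma computable_rec_nat:
  assumes "computable n f" and "computable (Suc (Suc n)) (\<lambda>ys. h (ys ! 0) (ys ! 1) (tl (tl ys)))"
    and "computable n a"
  shows "computable n (\<lambda>xs. rec_nat (f xs) (\<lambda>k v. h k v xs) (a xs))"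
proof -
  obtain p q where p: "\<And>xs. length xs = n \<Longrightarrow> recf_eval p xs (f xs)"
    and q: "\<And>ys. length ys = Suc (Suc n) \<Longrightarrow> recf_eval q ys (h (ys ! 0) (ys ! 1) (tl (tl ys)))"
    using assms unfolding computable_def by blast
  have step: "recf_eval (PrimRec p q) (k # xs) (rec_nat (f xs) (\<lambda>k v. h k v xs) k)"
    if "length xs = n" for k xs
  proof (induction k)
    case 0
    show ?case using p that by (auto intro: recf_eval.PrimRec_0)
  next
    case (Suc k)
    show ?case
      using q[of "k # rec_nat (f xs) (\<lambda>k v. h k v xs) k # xs"] that
      by (auto intro: recf_eval.PrimRec_Suc[OF Suc])
  qed
  have "recf_eval (PrimRec p q) ys (rec_nat (f (tl ys)) (\<lambda>k v. h k v (tl ys)) (ys ! 0))"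
    if "length ys = Suc n" for ys
    using that step[of "tl ys" "ys ! 0"] by (cases ys) auto
  then have "computable (Suc n) (\<lambda>ys. rec_nat (f (tl ys)) (\<lambda>k v. h k v (tl ys)) (ys ! 0))"
    unfolding computable_def by blast
  \<comment> \<open>\<open>PrimRec\<close> recurses on its first argument, so \<open>a xs\<close> is
    inserted in front of the parameters.\<close>
  from computable_compose[OF this, of n "\<lambda>xs. a xs # xs"] show ?thesis
    using assms(3) by (simp add: computable_list_Cons computable_list_id)
qed

lemma computable_add:
  assumes "computable n a" and "computable n b"
  shows "computable n (\<lambda>xs. a xs + b xs)"
proof -
  have *: "x + y = rec_nat x (\<lambda>k v. Suc v) y" for x y :: nat
    by (induction y) auto
  show ?thesis
    unfolding * by (intro computable_rec_nat computable_Suc computable_proj assms) auto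
qed

lemma computable_mult:
  assumes "computable n a" and "computable n b"
  shows "computable n (\<lambda>xs. a xs * b xs)"
proof -
  have *: "x * y = rec_nat 0 (\<lambda>k v. v + x) y" for x y :: nat
    by (induction y) auto
  show ?thesis
    unfolding *
    by (intro computable_rec_nat computable_add computable_shift computable_proj computable_const
        assms) auto
qed

lemma computable_diff:
  assumes "computable n a" and "computable n b"
  shows "computable n (\<lambda>xs. a xs - b xs)"
proof -
  have pred: "computable m (\<lambda>xs. f xs - 1)" if "computable m f" for m f
  proof -
    \<comment> \<open>The counter of the last step is the predecessor; iterating the predecessor
      gives truncated subtraction below.\<close>
    have *: "x - 1 = rec_nat 0 (\<lambda>k v. k) x" for x :: nat
      by (cases x) auto
    show ?thesis
      unfolding * by (intro computable_rec_nat computable_proj computable_const that) auto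
  qed
  have *: "x - y = rec_nat x (\<lambda>k v. v - 1) y" for x y :: nat
    by (induction y) auto
  have "computable n (\<lambda>xs. rec_nat (a xs) (\<lambda>k v. v - 1) (b xs))"
    by (intro computable_rec_nat pred computable_proj assms) auto
  then show ?thesis by (rule computable_cong) (rule *)
qed

lemma computable_if_eq:
  assumes "computable n a" and "computable n b" and "computable n c" and "computable n d"
  shows "computable n (\<lambda>xs. if a xs = b xs then c xs else d xs)"
proof -
  \<comment> \<open>With truncated subtraction, \<open>(x - y) + (y - x)\<close> is the distance of
    \<open>x\<close> and \<open>y\<close>, and 1 minus it is the indicator of equality.\<close>
  have *: "(if x = y then u else v) = (1 - ((x - y) + (y - x))) * u + (1 - (1 - ((x - y) + (y - x)))) * v"
    for x y u v :: nat
    by auto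
  show ?thesis
    unfolding * by (intro computable_add computable_mult computable_diff computable_const assms)
qed

lemma computable_sum:
  assumes "computable n a" and "computable (Suc n) (\<lambda>ys. h (ys ! 0) (tl ys))"
  shows "computable n (\<lambda>xs. \<Sum>k<a xs. h k xs)"
proof -
  have *: "(\<Sum>k<x. h k xs) = rec_nat 0 (\<lambda>k v. v + h k xs) x" for x xs
    by (induction x) auto
  \<comment> \<open>The recursion passes the partial sum as an extra second argument, which the
    summand has to skip.\<close>
  have "computable (Suc (Suc n)) (\<lambda>ys. h (ys ! 0) (tl (tl ys)))"
    using computable_compose[OF assms(2), of "Suc (Suc n)" "\<lambda>ys. ys ! 0 # tl (tl ys)"]
    by (simp add: computable_list_Cons computable_list_tl computable_list_id computable_proj)
  then show ?thesis
    unfolding *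
    by (intro computable_rec_nat computable_add computable_proj computable_const assms(1)) auto
qed

lemma computable_prod:
  assumes "computable n a" and "computable (Suc n) (\<lambda>ys. h (ys ! 0) (tl ys))"
  shows "computable n (\<lambda>xs. \<Prod>k<a xs. h k xs)"
proof -
  have *: "(\<Prod>k<x. h k xs) = rec_nat 1 (\<lambda>k v. v * h k xs) x" for x xs
    by (induction x) auto
  have "computable (Suc (Suc n)) (\<lambda>ys. h (ys ! 0) (tl (tl ys)))"
    using computable_compose[OF assms(2), of "Suc (Suc n)" "\<lambda>ys. ys ! 0 # tl (tl ys)"]
    by (simp add: computable_list_Cons computable_list_tl computable_list_id computable_proj)
  then show ?thesis
    unfolding *
    by (intro computable_rec_nat computable_mult computable_proj computable_const assms(1)) auto
qed

lemma computable_power2: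
  assumes "computable n a"
  shows "computable n (\<lambda>xs. 2 ^ a xs)"
proof -
  have *: "(2::nat) ^ x = rec_nat 1 (\<lambda>k v. v + v) x" for x :: nat
    by (induction x) auto
  show ?thesis
    unfolding *
    by (intro computable_rec_nat computable_add computable_proj computable_const assms) auto
qed

section \<open>Pairing and its inverse\<close>

lemma computable_prod_encode:
  assumes "computable n a" and "computable n b"
  shows "computable n (\<lambda>xs. prod_encode (a xs, b xs))"
proof -
  have *: "triangle x = (\<Sum>k<x. Suc k)" for x
    by (induction x) auto
  show ?thesis
    unfolding prod_encode_def case_prod_conv *
    by (intro computable_add computable_sum computable_Suc computable_proj assms) auto
qed

text \<open>Both components of a pair are bounded by its code, so decoding is a search in a finite
  square; by injectivity of \<open>prod_encode\<close> only one term can be nonzero. In this form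
  decoding is visibly computable.\<close>

lemma prod_decode_fst_eq_sum:
  "fst (prod_decode n) = (\<Sum>a<Suc n. \<Sum>b<Suc n. if prod_encode (a, b) = n then a else 0)"
proof -
  obtain a b where ab: "prod_decode n = (a, b)" by fastforce
  have n: "n = prod_encode (a, b)" using ab by (metis prod_decode_inverse)
  have "a < Suc n" "b < Suc n"
    unfolding n by (auto simp: less_Suc_eq_le le_prod_encode_1 le_prod_encode_2)
  have "(\<Sum>a'<Suc n. \<Sum>b'<Suc n. if prod_encode (a', b') = n then a' else 0)
      = (\<Sum>a'<Suc n. if a' = a then a else 0)"
    using \<open>b < Suc n\<close> by (intro sum.cong) (auto simp: n simp del: sum.lessThan_Suc)
  also have "\<dots> = a" using \<open>a < Suc n\<close> by (simp del: sum.lessThan_Suc)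
  finally show ?thesis using ab by simp
qed

lemma prod_decode_snd_eq_sum:
  "snd (prod_decode n) = (\<Sum>a<Suc n. \<Sum>b<Suc n. if prod_encode (a, b) = n then b else 0)"
proof -
  obtain a b where ab: "prod_decode n = (a, b)" by fastforce
  have n: "n = prod_encode (a, b)" using ab by (metis prod_decode_inverse)
  have "a < Suc n" "b < Suc n"
    unfolding n by (auto simp: less_Suc_eq_le le_prod_encode_1 le_prod_encode_2)
  have "(\<Sum>a'<Suc n. \<Sum>b'<Suc n. if prod_encode (a', b') = n then b' else 0)
      = (\<Sum>a'<Suc n. if a' = a then b else 0)"
    using \<open>b < Suc n\<close> by (intro sum.cong) (auto simp: n simp del: sum.lessThan_Suc)
  also have "\<dots> = b" using \<open>a < Suc n\<close> by (simp del: sum.lessThan_Suc)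
  finally show ?thesis using ab by simp
qed

lemma computable_prod_decode_fst:
  assumes "computable n a"
  shows "computable n (\<lambda>xs. fst (prod_decode (a xs)))"
proof -
  \<comment> \<open>Treating the bare argument first keeps its occurrences under the two sums plain
    projections; an arbitrary \<open>a\<close> is substituted afterwards.\<close>
  have "computable 1 (\<lambda>ys. fst (prod_decode (ys ! 0)))"
    unfolding prod_decode_fst_eq_sum
    by (intro computable_sum computable_if_eq computable_prod_encode computable_Suc computable_proj
        computable_proj_tl computable_proj_tl_tl computable_const) auto
  then show ?thesis using assms by (rule computable_compose1)
qed

lemma computable_prod_decode_snd:
  assumes "computable n a"
  shows "computable n (\<lambda>xs. snd (prod_decode (a xs)))"
proof -
  have "computable 1 (\<lambda>ys. snd (prod_decode (ys ! 0)))"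
    unfolding prod_decode_snd_eq_sum
    by (intro computable_sum computable_if_eq computable_prod_encode computable_Suc computable_proj
        computable_proj_tl computable_proj_tl_tl computable_const) auto
  then show ?thesis using assms by (rule computable_compose1)
qed

lemmas computable_intros =
  computable_proj computable_const computable_Suc computable_add computable_mult computable_diff
  computable_power2 computable_prod_encode computable_prod_decode_fst computable_prod_decode_snd


section \<open>Clocked evaluation\<close>

text \<open>The value is \<open>0\<close> if the bound \<open>s\<close> does not suffice and the successor of the result otherwise.\<close>

fun clocked :: "recf \<Rightarrow> nat \<Rightarrow> nat list \<Rightarrow> nat" where
  "clocked Zero s xs = 1"
| "clocked Succ s xs = (if length xs = 1 then Suc (Suc (xs ! 0)) else 0)"
| "clocked (Proj i) s xs = (if i < length xs then Suc (xs ! i) else 0)"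
| "clocked (Comp f gs) s xs =
     (if (\<Prod>g\<leftarrow>gs. clocked g s xs) = 0 then 0 else clocked f s (map (\<lambda>g. clocked g s xs - 1) gs))"
| "clocked (PrimRec f g) s xs =
     (if xs = [] then 0
      else rec_nat (clocked f s (tl xs))
        (\<lambda>k v. if v = 0 then 0 else clocked g s (k # (v - 1) # tl xs)) (xs ! 0))"
| "clocked (Mu f) s xs =
     (\<Sum>n<s. if clocked f s (n # xs) = 1
             then if (\<Prod>m<n. clocked f s (m # xs) - 1) = 0 then 0 else Suc n else 0)"

text \<open>The factor \<open>clocked f s (m # xs) - 1\<close> vanishes both when the bound does not
  suffice and when the value is 0, so a term survives only at a zero of \<open>f\<close> preceded by
  positive values. Such a zero is unique, hence the sum reduces to one term.\<close>

lemma clocked_Mu_eq_Suc_iff: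
  "clocked (Mu f) s xs = Suc n \<longleftrightarrow>
     n < s \<and> clocked f s (n # xs) = 1 \<and> (\<forall>m<n. clocked f s (m # xs) > 1)"
proof -
  define P where "P k \<longleftrightarrow> clocked f s (k # xs) = 1 \<and> (\<forall>m<k. clocked f s (m # xs) > 1)" for k
  have eq: "clocked (Mu f) s xs = (\<Sum>k<s. if P k then Suc k else 0)"
    by (auto simp: P_def intro!: sum.cong) (use linorder_not_le in blast)+
  have unique: "k = l" if "P k" "P l" for k l
    using that unfolding P_def by (metis less_irrefl nat_neq_iff)
  have val: "clocked (Mu f) s xs = Suc k" if "P k" "k < s" for k
  proof -
    have "(\<Sum>l<s. if P l then Suc l else 0) = (\<Sum>l<s. if l = k then Suc k else 0)"
      using that unique by (intro sum.cong) auto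
    then show ?thesis using eq that by simp
  qed
  show ?thesis
  proof
    assume L: "clocked (Mu f) s xs = Suc n"
    then obtain k where "k < s" "P k"
      unfolding eq by (metis (mono_tags, lifting) lessThan_iff nat.distinct(1) sum.neutral)
    with val[of k] L show "n < s \<and> clocked f s (n # xs) = 1 \<and> (\<forall>m<n. clocked f s (m # xs) > 1)"
      unfolding P_def by simp
  qed (use val P_def in blast)
qed

text \<open>A nonzero product means that every argument program has returned; subtracting 1 then
  recovers the values. The shape mirrors the rule \<open>Comp\<close>, so that the inductions below
  run in parallel to it.\<close>

lemma clocked_Comp_eq_Suc_iff:
  "clocked (Comp f gs) s xs = Suc y \<longleftrightarrow>
     (\<exists>zs. list_all2 (\<lambda>g z. clocked g s xs = Suc z) gs zs \<and> clocked f s zs = Suc y)"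
proof
  assume L: "clocked (Comp f gs) s xs = Suc y"
  then have "\<forall>g\<in>set gs. 0 < clocked g s xs"
    by (auto simp: prod_list_zero_iff image_iff split: if_splits)
  then have "list_all2 (\<lambda>g z. clocked g s xs = Suc z) gs (map (\<lambda>g. clocked g s xs - 1) gs)"
    by (auto simp: list_all2_map2 list_all2_same)
  with L show "\<exists>zs. list_all2 (\<lambda>g z. clocked g s xs = Suc z) gs zs \<and> clocked f s zs = Suc y"
    by (auto split: if_splits)
next
  assume "\<exists>zs. list_all2 (\<lambda>g z. clocked g s xs = Suc z) gs zs \<and> clocked f s zs = Suc y"
  then obtain zs where zs: "list_all2 (\<lambda>g z. clocked g s xs = Suc z) gs zs" "clocked f s zs = Suc y"
    by blast
  from zs(1) have "map (\<lambda>g. clocked g s xs - 1) gs = zs" "(\<Prod>g\<leftarrow>gs. clocked g s xs) \<noteq> 0"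
    by (induction rule: list_all2_induct) auto
  with zs(2) show "clocked (Comp f gs) s xs = Suc y" by simp
qed

lemma clocked_PrimRec_0: "clocked (PrimRec f g) s (0 # xs) = clocked f s xs"
  by simp

lemma clocked_PrimRec_Suc_eq_Suc_iff:
  "clocked (PrimRec f g) s (Suc n # xs) = Suc y \<longleftrightarrow>
     (\<exists>z. clocked (PrimRec f g) s (n # xs) = Suc z \<and> clocked g s (n # z # xs) = Suc y)"
proof -
  have "clocked (PrimRec f g) s (Suc n # xs) = (if clocked (PrimRec f g) s (n # xs) = 0 then 0
      else clocked g s (n # (clocked (PrimRec f g) s (n # xs) - 1) # xs))"
    by (simp cong: if_cong)
  then show ?thesis
    by (cases "clocked (PrimRec f g) s (n # xs)") (simp_all del: clocked.simps)
qed

text \<open>The bound enters only through \<open>Mu\<close>, where it limits the candidates.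
  Enlarging it leaves finished subcomputations unchanged, and the conditions on the first zero
  concern only finished ones.\<close>

lemma clocked_mono: "clocked r s xs = Suc y \<Longrightarrow> s \<le> t \<Longrightarrow> clocked r t xs = Suc y"
proof (induction r arbitrary: xs y)
  case (Comp f gs)
  then obtain zs where "list_all2 (\<lambda>g z. clocked g s xs = Suc z) gs zs" "clocked f s zs = Suc y"
    unfolding clocked_Comp_eq_Suc_iff by blast
  then have "list_all2 (\<lambda>g z. clocked g t xs = Suc z) gs zs" "clocked f t zs = Suc y"
    using Comp.IH Comp.prems(2) by (auto simp: list_all2_conv_all_nth)
  then show ?case unfolding clocked_Comp_eq_Suc_iff by blast
next
  case (PrimRec f g)
  have "clocked (PrimRec f g) t (n # ys) = Suc y" if "clocked (PrimRec f g) s (n # ys) = Suc y"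
    for n ys y
    using that
  proof (induction n arbitrary: y)
    case 0
    then show ?case unfolding clocked_PrimRec_0 using PrimRec.IH(1) PrimRec.prems(2) by blast
  next
    case (Suc n)
    from Suc.prems show ?case unfolding clocked_PrimRec_Suc_eq_Suc_iff
      using Suc.IH PrimRec.IH(2) PrimRec.prems(2) by blast
  qed
  with PrimRec.prems(1) show ?case by (cases xs) auto
next
  case (Mu f)
  from Mu.prems(1) have n: "y < s" "clocked f s (y # xs) = 1" "\<forall>m<y. clocked f s (m # xs) > 1"
    unfolding clocked_Mu_eq_Suc_iff by auto
  have "clocked f t (y # xs) = 1" using n(2) Mu.IH Mu.prems(2) by simp
  moreover have "clocked f t (m # xs) > 1" if "m < y" for m
  proof -
    have "1 < clocked f s (m # xs)" using n(3) that by blast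
    then obtain v where "clocked f s (m # xs) = Suc v" "v > 0"
      by (cases "clocked f s (m # xs)") auto
    then show ?thesis using Mu.IH Mu.prems(2) by simp
  qed
  ultimately show ?case
    unfolding clocked_Mu_eq_Suc_iff using n(1) Mu.prems(2) by simp
qed (auto split: if_splits)

lemma clocked_stable: "0 < clocked r s xs \<Longrightarrow> s \<le> t \<Longrightarrow> clocked r t xs = clocked r s xs"
  using clocked_mono[of r s xs "clocked r s xs - 1" t] by simp

lemma clocked_sound: "clocked r s xs = Suc y \<Longrightarrow> recf_eval r xs y"
proof (induction r arbitrary: xs y)
  case Zero
  then show ?case by (auto intro: recf_eval.Zero)
next
  case Succ
  then show ?case by (auto simp: length_Suc_conv intro: recf_eval.Succ split: if_splits)
next
  case (Proj i)
  then show ?case by (auto intro: recf_eval.Proj split: if_splits)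
next
  case (Comp f gs)
  then obtain zs where "list_all2 (\<lambda>g z. clocked g s xs = Suc z) gs zs" "clocked f s zs = Suc y"
    unfolding clocked_Comp_eq_Suc_iff by blast
  then have "list_all2 (\<lambda>g z. recf_eval g xs z) gs zs" "recf_eval f zs y"
    using Comp.IH by (auto simp: list_all2_conv_all_nth)
  then show ?case by (rule recf_eval.Comp)
next
  case (PrimRec f g)
  have "recf_eval (PrimRec f g) (n # ys) y" if "clocked (PrimRec f g) s (n # ys) = Suc y"
    for n ys y
    using that
  proof (induction n arbitrary: y)
    case 0
    then show ?case unfolding clocked_PrimRec_0 using PrimRec.IH(1) recf_eval.PrimRec_0 by blast
  next
    case (Suc n)
    from Suc.prems show ?case unfolding clocked_PrimRec_Suc_eq_Suc_iff
      using Suc.IH PrimRec.IH(2) recf_eval.PrimRec_Suc by blast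
  qed
  with PrimRec.prems show ?case by (cases xs) auto
next
  case (Mu f)
  then have "clocked f s (y # xs) = Suc 0" "\<forall>m<y. clocked f s (m # xs) > 1"
    unfolding clocked_Mu_eq_Suc_iff by auto
  then show ?case
    using Mu.IH by (intro recf_eval.Mu) (auto, metis Suc_lessE)
qed

text \<open>Each subcomputation has its own sufficient bound; there are finitely many, so by
  monotonicity their maximum serves for all.\<close>

lemma clocked_complete: "recf_eval r xs y \<Longrightarrow> \<exists>s. clocked r s xs = Suc y"
proof (induction rule: recf_eval.induct)
  case (Comp xs gs zs f y)
  have "\<exists>s. list_all2 (\<lambda>g z. clocked g s xs = Suc z) gs zs"
    using Comp.IH(1)
  proof (induction rule: list_all2_induct)
    case (Cons g gs z zs)
    then obtain s s' where "clocked g s xs = Suc z" "list_all2 (\<lambda>g z. clocked g s' xs = Suc z) gs zs"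
      by blast
    then have "clocked g (max s s') xs = Suc z"
      "list_all2 (\<lambda>g z. clocked g (max s s') xs = Suc z) gs zs"
      by (auto elim!: clocked_mono list.rel_mono_strong)
    then show ?case by auto
  qed auto
  then obtain s s' where "list_all2 (\<lambda>g z. clocked g s xs = Suc z) gs zs" "clocked f s' zs = Suc y"
    using Comp.IH(2) by blast
  then have "list_all2 (\<lambda>g z. clocked g (max s s') xs = Suc z) gs zs"
    "clocked f (max s s') zs = Suc y"
    by (auto elim!: clocked_mono list.rel_mono_strong)
  then show ?case unfolding clocked_Comp_eq_Suc_iff by blast
next
  case (PrimRec_0 f xs y g)
  then show ?case by simp
next
  case (PrimRec_Suc f g n xs z y)
  then obtain s s' where "clocked (PrimRec f g) s (n # xs) = Suc z" "clocked g s' (n # z # xs) = Suc y"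
    by blast
  then have "clocked (PrimRec f g) (max s s') (n # xs) = Suc z"
    "clocked g (max s s') (n # z # xs) = Suc y"
    using clocked_mono max.cobounded1 max.cobounded2 by blast+
  then show ?case unfolding clocked_PrimRec_Suc_eq_Suc_iff by blast
next
  case (Mu f n xs)
  \<comment> \<open>The induction hypothesis gives a separate bound for every \<open>m < n\<close>;
    induction on the initial segment merges them.\<close>
  have "\<exists>s. \<forall>m<k. clocked f s (m # xs) > 1" if "k \<le> n" for k
    using that
  proof (induction k)
    case (Suc k)
    then obtain s where s: "\<forall>m<k. clocked f s (m # xs) > 1" by auto
    obtain s' where s': "clocked f s' (k # xs) > 1"
      using Mu.IH(2) Suc.prems by (metis Suc_le_eq Suc_less_eq One_nat_def)
    show ?case
      using s s' clocked_stable[of f s _ "max s s'"] clocked_stable[of f s' _ "max s s'"]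
      by (intro exI[of _ "max s s'"]) (auto simp: less_Suc_eq)
  qed auto
  then obtain s s' where "\<forall>m<n. clocked f s (m # xs) > 1" "clocked f s' (n # xs) = 1"
    using Mu.IH(1) by (metis One_nat_def le_refl)
  \<comment> \<open>\<open>Suc n\<close> is included because the clocked search inspects only
    arguments strictly below its bound.\<close>
  moreover define u where "u = max (Suc n) (max s s')"
  ultimately have "\<forall>m<n. clocked f u (m # xs) > 1" "clocked f u (n # xs) = 1" "n < u"
    using clocked_stable[of f s _ u] clocked_stable[of f s' _ u] by auto
  then show ?case unfolding clocked_Mu_eq_Suc_iff by blast
qed simp_all

text \<open>For each fixed \<open>r\<close> the clocked value is built from finite sums, products
  and recursions, so induction on \<open>r\<close> applies: unbounded search has become a bounded
  sum.\<close>

lemma computable_clocked: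
  assumes "computable_list n m L" and "computable n a"
  shows "computable n (\<lambda>xs. clocked r (a xs) (L xs))"
proof -
  \<comment> \<open>The bound comes as first argument. The length \<open>m\<close> stays arbitrary,
    since subprograms are run on lists of other lengths.\<close>
  have "computable (Suc m) (\<lambda>ys. clocked r (ys ! 0) (tl ys))" for m
  proof (induction r arbitrary: m)
    case Zero
    show ?case by (simp add: computable_const)
  next
    case Succ
    show ?case
    proof (cases "m = 1")
      case True
      then show ?thesis
        by (intro computable_cong[OF computable_Suc[OF computable_Suc[OF computable_proj_tl]], of 0])
          auto
    next
      case False
      then show ?thesis by (intro computable_cong[OF computable_const[of _ 0]]) auto
    qed
  next
    case (Proj i)
    show ?case
    proof (cases "i < m")
      case True
      then show ?thesis
        by (intro computable_cong[OF computable_Suc[OF computable_proj_tl], of i]) auto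
    next
      case False
      then show ?thesis by (intro computable_cong[OF computable_const[of _ 0]]) auto
    qed
  next
    case (Comp f gs)
    have P: "computable (Suc m) (\<lambda>ys. \<Prod>g\<leftarrow>gs. clocked g (ys ! 0) (tl ys))"
      using Comp.IH(2) by (induction gs) (auto intro: computable_const computable_mult)
    have "computable_list (Suc m) (length gs) (\<lambda>ys. map (\<lambda>g. clocked g (ys ! 0) (tl ys) - 1) gs)"
      using Comp.IH(2)
      by (induction gs)
        (auto simp del: One_nat_def intro!: computable_list_Nil computable_list_Cons computable_diff computable_const)
    from computable_compose[OF Comp.IH(1) computable_list_Cons[OF computable_proj this, of 0]]
    have "computable (Suc m)
        (\<lambda>ys. clocked f (ys ! 0) (map (\<lambda>g. clocked g (ys ! 0) (tl ys) - 1) gs))"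
      by simp
    then show ?case
      unfolding clocked.simps by (intro computable_if_eq P computable_const)
  next
    case (PrimRec f g)
    show ?case
    proof (cases m)
      case 0
      then show ?thesis by (intro computable_cong[OF computable_const[of _ 0]]) (auto simp: length_Suc_conv)
    next
      case (Suc k)
      have f: "computable (Suc m) (\<lambda>ys. clocked f (ys ! 0) (tl (tl ys)))"
        using computable_compose[OF PrimRec.IH(1)[of k], of "Suc m" "\<lambda>ys. ys ! 0 # tl (tl ys)"]
        by (simp add: Suc computable_list_Cons computable_list_tl computable_list_id computable_proj)
      \<comment> \<open>The arguments are, in order, the counter, the previous value, the bound, the
        recursion argument and the parameters; they are rearranged into the bound followed by the
        input of \<open>g\<close>.\<close>
      have L: "computable_list (Suc (Suc (Suc m))) (Suc (Suc (Suc k)))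
          (\<lambda>zs. tl (tl zs) ! 0 # zs ! 0 # (zs ! 1 - 1) # tl (tl (tl (tl zs))))"
        unfolding Suc
        by (intro computable_list_Cons computable_list_tl computable_list_id computable_proj
            computable_diff computable_const
            computable_proj_tl_tl) auto
      have g: "computable (Suc (Suc (Suc m))) (\<lambda>zs. if zs ! 1 = 0 then 0
          else clocked g (tl (tl zs) ! 0) (zs ! 0 # (zs ! 1 - 1) # tl (tl (tl (tl zs)))))"
        using computable_compose[OF PrimRec.IH(2) L]
        by (intro computable_if_eq computable_proj computable_const) auto
      have "computable (Suc m) (\<lambda>ys. rec_nat (clocked f (ys ! 0) (tl (tl ys)))
        (\<lambda>k v. if v = 0 then 0 else clocked g (ys ! 0) (k # (v - 1) # tl (tl ys))) (tl ys ! 0))"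
        by (rule computable_rec_nat[OF f g]) (rule computable_proj_tl, simp add: Suc)
      then show ?thesis
        by (rule computable_cong) (auto simp: Suc length_Suc_conv)
    qed
  next
    case (Mu f)
    \<comment> \<open>The sum puts its variable before the bound, and the product in
      \<open>c2\<close> puts a second variable before that.\<close>
    have c1: "computable (Suc (Suc m)) (\<lambda>zs. clocked f (tl zs ! 0) (zs ! 0 # tl (tl zs)))"
      using computable_compose[OF Mu.IH[of "Suc m"],
          of "Suc (Suc m)" "\<lambda>zs. tl zs ! 0 # zs ! 0 # tl (tl zs)"]
      by (simp add: computable_list_Cons computable_list_tl computable_list_id computable_proj
          computable_proj_tl)
    have c2: "computable (Suc (Suc (Suc m)))
        (\<lambda>zs. clocked f (tl (tl zs) ! 0) (zs ! 0 # tl (tl (tl zs))))"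
      using computable_compose[OF Mu.IH[of "Suc m"],
          of "Suc (Suc (Suc m))" "\<lambda>zs. tl (tl zs) ! 0 # zs ! 0 # tl (tl (tl zs))"]
      by (simp add: computable_list_Cons computable_list_tl computable_list_id computable_proj computable_proj_tl_tl)
    show ?case
      unfolding clocked.simps
      by (intro computable_sum computable_if_eq computable_prod computable_diff computable_const
          computable_proj computable_Suc c1 c2) auto
  qed
  from computable_compose[OF this computable_list_Cons[OF assms(2,1)]] show ?thesis by simp
qed

section \<open>Semidecidable predicates\<close>

definition semidecidable :: "nat \<Rightarrow> (nat list \<Rightarrow> bool) \<Rightarrow> bool" where
  "semidecidable n P \<longleftrightarrow> (\<exists>r. \<forall>xs. length xs = n \<longrightarrow> (P xs \<longleftrightarrow> (\<exists>y. recf_eval r xs y)))"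

lemma recf_eval_Comp_iff:
  "recf_eval (Comp f gs) xs y \<longleftrightarrow> (\<exists>zs. list_all2 (\<lambda>g z. recf_eval g xs z) gs zs \<and> recf_eval f zs y)"
proof
  assume "recf_eval (Comp f gs) xs y"
  then show "\<exists>zs. list_all2 (\<lambda>g z. recf_eval g xs z) gs zs \<and> recf_eval f zs y"
    by (cases rule: recf_eval.cases) blast
qed (use recf_eval.Comp in blast)

text \<open>\<open>Comp\<close> is strict, and \<open>Zero\<close> is defined on every list, so
  \<open>Comp Zero [p, q]\<close> halts exactly when \<open>p\<close> and \<open>q\<close> both
  do.\<close>

lemma semidecidable_conj:
  assumes "semidecidable n P" and "semidecidable n Q"
  shows "semidecidable n (\<lambda>xs. P xs \<and> Q xs)"
proof -
  obtain p q where "\<And>xs. length xs = n \<Longrightarrow> P xs \<longleftrightarrow> (\<exists>y. recf_eval p xs y)"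
    and "\<And>xs. length xs = n \<Longrightarrow> Q xs \<longleftrightarrow> (\<exists>y. recf_eval q xs y)"
    using assms unfolding semidecidable_def by blast
  moreover have "(\<exists>y. recf_eval (Comp Zero [p, q]) xs y)
      \<longleftrightarrow> (\<exists>y. recf_eval p xs y) \<and> (\<exists>y. recf_eval q xs y)" for xs
    by (simp add: recf_eval_Comp_iff list_all2_Cons1) (use recf_eval.Zero in blast)
  ultimately show ?thesis
    unfolding semidecidable_def by (intro exI[of _ "Comp Zero [p, q]"]) simp
qed

lemma semidecidable_compose:
  assumes "semidecidable m P" and "computable_list n m L"
  shows "semidecidable n (\<lambda>xs. P (L xs))"
proof -
  obtain r rs where r: "\<And>xs. length xs = m \<Longrightarrow> P xs \<longleftrightarrow> (\<exists>y. recf_eval r xs y)"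
    and rs: "length rs = m"
      "\<And>xs. length xs = n \<Longrightarrow> list_all2 (\<lambda>r z. recf_eval r xs z) rs (L xs)"
    using assms unfolding semidecidable_def computable_list_def by blast
  have "P (L xs) \<longleftrightarrow> (\<exists>y. recf_eval (Comp r rs) xs y)" if len: "length xs = n" for xs
  proof -
    \<comment> \<open>By determinism the argument programs can feed only \<open>L xs\<close> into
      \<open>r\<close>, so the composite is undefined where \<open>r\<close> is.\<close>
    have "zs = L xs" if "list_all2 (\<lambda>r z. recf_eval r xs z) rs zs" for zs
      using that rs(2)[OF len] recf_eval_deterministic
      by (auto simp: list_all2_conv_all_nth intro!: nth_equalityI)
    then have "(\<exists>y. recf_eval (Comp r rs) xs y) \<longleftrightarrow> (\<exists>y. recf_eval r (L xs) y)"
      unfolding recf_eval_Comp_iff using rs(2)[OF len] by blast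
    moreover have "length (L xs) = m" using rs(1) rs(2)[OF len] by (simp add: list_all2_lengthD)
    ultimately show ?thesis using r by simp
  qed
  then show ?thesis unfolding semidecidable_def by blast
qed

section \<open>Computably enumerable sets and their indices\<close>

lemma ce_set_iff_semidecidable: "ce_set A \<longleftrightarrow> semidecidable 1 (\<lambda>xs. xs ! 0 \<in> A)"
proof
  assume "ce_set A"
  then obtain f r where "dom f = A" and "\<And>xs y. length xs = 1 \<Longrightarrow> f (xs ! 0) = Some y \<longleftrightarrow> recf_eval r xs y"
    unfolding ce_set_def partial_computable1_def partial_computable_def by blast
  then have "xs ! 0 \<in> A \<longleftrightarrow> (\<exists>y. recf_eval r xs y)" if "length xs = 1" for xs
    using that by auto
  then show "semidecidable 1 (\<lambda>xs. xs ! 0 \<in> A)" unfolding semidecidable_def by blast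
next
  assume "semidecidable 1 (\<lambda>xs. xs ! 0 \<in> A)"
  then obtain r where r: "\<And>xs. length xs = 1 \<Longrightarrow> xs ! 0 \<in> A \<longleftrightarrow> (\<exists>y. recf_eval r xs y)"
    unfolding semidecidable_def by blast
  have "partial_computable1 (\<lambda>x. run r [x])"
    unfolding partial_computable1_def partial_computable_iff
    by (rule exI[of _ r]) (auto simp: length_Suc_conv)
  moreover have "dom (\<lambda>x. run r [x]) = A"
    using r[of "[_]"] by (auto simp: run_eq_Some_iff)
  ultimately show "ce_set A" unfolding ce_set_def by blast
qed

lemma semidecidable_ce_set:
  assumes "ce_set A" and "computable n a"
  shows "semidecidable n (\<lambda>xs. a xs \<in> A)"
  using semidecidable_compose[of 1 "\<lambda>xs. xs ! 0 \<in> A" n "\<lambda>xs. [a xs]"] assms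
  by (simp add: ce_set_iff_semidecidable computable_list_Cons computable_list_Nil)

lemma ce_set_vimage:
  assumes "ce_set A" and "computable 1 (\<lambda>xs. f (xs ! 0))"
  shows "ce_set (f -` A)"
  using semidecidable_ce_set[OF assms] by (simp add: ce_set_iff_semidecidable)

lemma semidecidable_W:
  assumes "goedel_numbering \<phi>" and "computable n a" and "computable n b"
  shows "semidecidable n (\<lambda>xs. b xs \<in> W \<phi> (a xs))"
proof -
  obtain r where "\<And>xs y. length xs = 2 \<Longrightarrow> \<phi> (xs ! 0) (xs ! 1) = Some y \<longleftrightarrow> recf_eval r xs y"
    using assms(1) unfolding goedel_numbering_def partial_computable2_def partial_computable_def
    by blast
  then have "semidecidable 2 (\<lambda>xs. xs ! 1 \<in> W \<phi> (xs ! 0))"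
    unfolding semidecidable_def W_def by (intro exI[of _ r]) auto
  from semidecidable_compose[OF this, of n "\<lambda>xs. [a xs, b xs]"] assms(2,3) show ?thesis
    by (simp add: computable_list_Cons computable_list_Nil numeral_2_eq_2)
qed

text \<open>The reducibility clause of \<open>goedel_numbering\<close> acts as the s-m-n theorem:
  applied to the family \<open>run r [i, x]\<close>, it yields indices of the sections of
  \<open>R\<close> computably.\<close>

lemma uniform_index:
  assumes "goedel_numbering \<phi>" and "semidecidable 2 (\<lambda>xs. R (xs ! 0) (xs ! 1))"
  shows "\<exists>h. computable 1 (\<lambda>xs. h (xs ! 0)) \<and> (\<forall>i. W \<phi> (h i) = {x. R i x})"
proof -
  obtain r where r: "\<And>xs. length xs = 2 \<Longrightarrow> R (xs ! 0) (xs ! 1) \<longleftrightarrow> (\<exists>y. recf_eval r xs y)"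
    using assms(2) unfolding semidecidable_def by blast
  define f where "f i x = run r [i, x]" for i x
  have "partial_computable2 f"
    unfolding f_def partial_computable2_def partial_computable_iff
    by (rule exI[of _ r]) (auto simp: length_Suc_conv numeral_2_eq_2)
  then obtain h where "partial_computable1 (\<lambda>i. Some (h i))" and h: "\<And>i. \<phi> (h i) = f i"
    using assms(1) unfolding goedel_numbering_def by blast
  then have "computable 1 (\<lambda>xs. h (xs ! 0))"
    unfolding partial_computable1_def partial_computable_def computable_def by blast
  moreover have "W \<phi> (h i) = {x. R i x}" for i
    using r[of "[i, _]"] unfolding W_def h f_def dom_def by (auto simp: run_eq_Some_iff)
  ultimately show ?thesis by blast
qed

lemma ce_set_index:
  assumes "goedel_numbering \<phi>" and "ce_set A"
  shows "\<exists>i. W \<phi> i = A"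
proof -
  have "semidecidable 2 (\<lambda>xs. xs ! 1 \<in> A)"
    by (intro semidecidable_ce_set assms computable_proj) simp
  from uniform_index[OF assms(1), of "\<lambda>i x. x \<in> A"] this show ?thesis by auto
qed

text \<open>Dovetailing: the search runs through codes of pairs of a candidate and a bound until the
  clocked program returns, and gives back the candidate. Trying candidates one after the other
  without a bound could get stuck where the program diverges.\<close>

lemma semidecidable_selection:
  assumes "semidecidable (Suc n) P"
  shows "\<exists>f. partial_computable n f \<and>
    (\<forall>xs. length xs = n \<longrightarrow> (\<exists>k. P (k # xs)) \<longrightarrow> (\<exists>k. f xs = Some k \<and> P (k # xs)))"
proof -
  obtain r where r: "\<And>xs. length xs = Suc n \<Longrightarrow> P xs \<longleftrightarrow> (\<exists>y. recf_eval r xs y)"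
    using assms unfolding semidecidable_def by blast
  \<comment> \<open>Total, and 0 exactly when the clocked run has returned, which is the test that
    \<open>Mu\<close> needs.\<close>
  define g where "g ys = 1 - clocked r (snd (prod_decode (ys ! 0))) (fst (prod_decode (ys ! 0)) # tl ys)"
    for ys
  have "computable_list (Suc n) (Suc n) (\<lambda>ys. fst (prod_decode (ys ! 0)) # tl ys)"
    by (intro computable_prod_decode_fst computable_list_Cons computable_list_tl computable_list_id
        computable_proj) simp
  then have "computable (Suc n) g"
    unfolding g_def
    by (intro computable_diff computable_const computable_prod_decode_snd computable_proj
        computable_clocked[of _ "Suc n"]) simp_all
  then obtain p where p: "\<And>ys. length ys = Suc n \<Longrightarrow> recf_eval p ys (g ys)"
    unfolding computable_def by blast
  have "computable 1 (\<lambda>ys. fst (prod_decode (ys ! 0)))"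
    by (intro computable_prod_decode_fst computable_proj) simp
  then obtain q where q: "\<And>ys. length ys = 1 \<Longrightarrow> recf_eval q ys (fst (prod_decode (ys ! 0)))"
    unfolding computable_def by blast
  have "\<exists>k. run (Comp q [Mu p]) xs = Some k \<and> P (k # xs)" if len: "length xs = n" and P: "P (k # xs)" for xs k
  proof -
    obtain y where "recf_eval r (k # xs) y" using r[of "k # xs"] len P by auto
    then obtain s where "clocked r s (k # xs) = Suc y" using clocked_complete by blast
    then have ex: "g (prod_encode (k, s) # xs) = 0" by (simp add: g_def)
    \<comment> \<open>\<open>Mu\<close> yields the first zero, which may differ from
      \<open>prod_encode (k, s)\<close>; hence \<open>P\<close> is established afresh for the
      candidate found.\<close>
    define u where "u = (LEAST u. g (u # xs) = 0)"
    have u: "g (u # xs) = 0" unfolding u_def using ex by (rule LeastI)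
    have pos: "0 < g (m # xs)" if "m < u" for m
      using that not_less_Least unfolding u_def by blast
    have p': "recf_eval p (m # xs) (g (m # xs))" for m
      using p len by simp
    have "recf_eval p (u # xs) 0" using p'[of u] u by simp
    moreover have "\<forall>m<u. \<exists>y. 0 < y \<and> recf_eval p (m # xs) y" using pos p' by blast
    ultimately have "recf_eval (Mu p) xs u" by (rule recf_eval.Mu)
    then have "run (Comp q [Mu p]) xs = Some (fst (prod_decode u))"
      using q[of "[u]"] by (auto simp: run_eq_Some_iff recf_eval_Comp_iff list_all2_Cons1)
    moreover obtain z where "clocked r (snd (prod_decode u)) (fst (prod_decode u) # xs) = Suc z"
      using u unfolding g_def
      by (cases "clocked r (snd (prod_decode u)) (fst (prod_decode u) # xs)") auto
    then have "recf_eval r (fst (prod_decode u) # xs) z" by (rule clocked_sound)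
    then have "P (fst (prod_decode u) # xs)"
      using r[of "fst (prod_decode u) # xs"] len by auto
    ultimately show ?thesis by blast
  qed
  then show ?thesis
    unfolding partial_computable_iff by (intro exI[of _ "run (Comp q [Mu p])"]) blast
qed

lemma partial_computable_map_option:
  assumes "partial_computable n f" and "computable 1 (\<lambda>xs. h (xs ! 0))"
  shows "partial_computable n (\<lambda>xs. map_option h (f xs))"
proof -
  obtain r q where r: "\<And>xs y. length xs = n \<Longrightarrow> f xs = Some y \<longleftrightarrow> recf_eval r xs y"
    and q: "\<And>xs. length xs = 1 \<Longrightarrow> recf_eval q xs (h (xs ! 0))"
    using assms unfolding partial_computable_def computable_def by blast
  have "recf_eval q [z] y \<longleftrightarrow> y = h z" for z y
    using q[of "[z]"] recf_eval_deterministic by auto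
  then show ?thesis
    unfolding partial_computable_def using r
    by (intro exI[of _ "Comp q [r]"]) (auto simp: recf_eval_Comp_iff list_all2_Cons1)
qed


section \<open>Quasi-metric spaces with a dense sequence\<close>

context quasi_metric_space
begin

text \<open>Makes the statements of this context available for the conjugate, so that each is proved
  for one distance only.\<close>

lemma conj_dist_quasi_metric_space: "quasi_metric_space X (conj_dist \<delta>)"
proof
  fix x y z assume "x \<in> X" "y \<in> X" "z \<in> X"
  then show "conj_dist \<delta> x z \<le> conj_dist \<delta> x y + conj_dist \<delta> y z"
    using triangle[of z y x] by (simp add: conj_dist_def)
qed (simp_all add: conj_dist_def nonneg refl zero_imp_eq)

lemma openin_qball: "x \<in> X \<Longrightarrow> 0 < r \<Longrightarrow> openin (qtopology X \<delta>) (qball X \<delta> x r)"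
  unfolding qtopology_def by (rule topology_generated_by_Basis) blast

text \<open>Induction on the generation of the topology. Inside a generating ball of radius
  \<open>r\<close> around \<open>x\<close>, the point \<open>y\<close> keeps the radius
  \<open>r - \<delta> x y\<close>.\<close>

lemma qball_subset:
  assumes "openin (qtopology X \<delta>) U" and "y \<in> U"
  shows "\<exists>r>0. qball X \<delta> y r \<subseteq> U"
proof -
  have "generate_topology_on {qball X \<delta> x r | x r. x \<in> X \<and> 0 < r} U"
    using assms(1) unfolding qtopology_def openin_topology_generated_by_iff .
  then show ?thesis using assms(2)
  proof (induction arbitrary: y rule: generate_topology_on.induct)
    case (Int a b)
    then obtain r s where "r > 0" "s > 0" "qball X \<delta> y r \<subseteq> a" "qball X \<delta> y s \<subseteq> b"
      by blast
    then show ?case by (intro exI[of _ "min r s"]) (auto simp: qball_def)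
  next
    case (UN K)
    then show ?case by (meson Union_iff Union_upper subset_trans)
  next
    case (Basis s)
    then obtain x r where s: "s = qball X \<delta> x r" "x \<in> X" by blast
    then have y: "y \<in> X" "\<delta> x y < r" using Basis.prems by (auto simp: qball_def)
    have "qball X \<delta> y (r - \<delta> x y) \<subseteq> s"
      unfolding s(1) qball_def using triangle[OF s(2) y(1)] by fastforce
    then show ?case using y(2) by (intro exI[of _ "r - \<delta> x y"]) simp
  qed auto
qed

lemma topspace_qtopology: "topspace (qtopology X \<delta>) = X"
proof
  show "topspace (qtopology X \<delta>) \<subseteq> X"
    unfolding qtopology_def topology_generated_by_topspace by (auto simp: qball_def)
  show "X \<subseteq> topspace (qtopology X \<delta>)"
  proof
    fix x assume "x \<in> X"
    then have "x \<in> qball X \<delta> x 1" by (simp add: qball_def refl)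
    then show "x \<in> topspace (qtopology X \<delta>)"
      using openin_subset[OF openin_qball[OF \<open>x \<in> X\<close>, of 1]] by auto
  qed
qed

end

text \<open>Density for the symmetrised distance is stated as two inequalities, a form invariant
  under passing to the conjugate.\<close>

locale dense_quasi_metric_space = quasi_metric_space X \<delta> for X :: "'a set" and \<delta> +
  fixes \<beta> :: "nat \<Rightarrow> 'a"
  assumes \<beta>_in: "\<beta> a \<in> X"
    and dense: "\<lbrakk>y \<in> X; 0 < \<epsilon>\<rbrakk> \<Longrightarrow> \<exists>a. \<delta> (\<beta> a) y < \<epsilon> \<and> \<delta> y (\<beta> a) < \<epsilon>"
begin

lemma conj_dist_dense_quasi_metric_space: "dense_quasi_metric_space X (conj_dist \<delta>) \<beta>"
proof -
  interpret c: quasi_metric_space X "conj_dist \<delta>" by (rule conj_dist_quasi_metric_space)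
  show ?thesis
    by unfold_locales (use \<beta>_in dense in \<open>auto simp: conj_dist_def conj_commute\<close>)
qed

text \<open>A centre \<open>\<beta> a\<close> within \<open>1 / 2 ^ e\<close> of \<open>u\<close> in
  both directions is recorded by the diagonal triple \<open>triple a a e\<close>, hence is equally
  close to \<open>v\<close>. So \<open>\<delta> u v\<close> is below \<open>2 / 2 ^ e\<close> for
  every \<open>e\<close>, and likewise with the points exchanged.\<close>

lemma approximations_inj:
  assumes "y \<in> X" and "z \<in> X" and "approximations \<delta> \<beta> y = approximations \<delta> \<beta> z"
  shows "y = z"
proof -
  have close: "\<delta> u v \<le> 0" if uv: "u \<in> X" "v \<in> X" "approximations \<delta> \<beta> u = approximations \<delta> \<beta> v" for u v
  proof (rule field_le_epsilon)
    fix \<epsilon> :: real assume "0 < \<epsilon>"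
    then obtain e where "(1 / 2) ^ e < \<epsilon> / 2"
      using real_arch_pow_inv[of "\<epsilon> / 2" "1 / 2"] by auto
    then have e: "1 / 2 ^ e < \<epsilon> / 2" by (simp add: power_one_over)
    obtain a where a: "\<delta> (\<beta> a) u < 1 / 2 ^ e" "\<delta> u (\<beta> a) < 1 / 2 ^ e"
      using dense[OF uv(1), of "1 / 2 ^ e"] by auto
    then have "triple a a e \<in> approximations \<delta> \<beta> u"
      unfolding approximations_def by blast
    then have "triple a a e \<in> approximations \<delta> \<beta> v" unfolding uv(3) .
    then have "\<delta> (\<beta> a) v < 1 / 2 ^ e" unfolding approximations_def by auto
    then show "\<delta> u v \<le> 0 + \<epsilon>" using triangle[OF uv(1) \<beta>_in uv(2), of a] a e by linarith
  qed
  show ?thesis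
    using close[of y z] close[of z y] assms nonneg by (intro zero_imp_eq) (auto intro: antisym)
qed

section \<open>The numbering of the computable points\<close>

lemma point_numbering_eq_Some_iff:
  "point_numbering \<phi> X \<delta> \<beta> i = Some y \<longleftrightarrow>
     y \<in> computable_points X \<delta> \<beta> \<and> W \<phi> i = approximations \<delta> \<beta> y"
proof -
  have "(THE z. z \<in> computable_points X \<delta> \<beta> \<and> W \<phi> i = approximations \<delta> \<beta> z) = y"
    if "y \<in> computable_points X \<delta> \<beta>" "W \<phi> i = approximations \<delta> \<beta> y" for y
    using that approximations_inj by (intro the_equality) (auto simp: computable_points_def)
  then show ?thesis unfolding point_numbering_def by auto
qed

lemma ran_point_numbering:
  assumes "goedel_numbering \<phi>"
  shows "ran (point_numbering \<phi> X \<delta> \<beta>) = computable_points X \<delta> \<beta>"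
  unfolding ran_def point_numbering_eq_Some_iff
  using ce_set_index[OF assms] by (auto simp: computable_points_def)

section \<open>Bases of balls and strong inclusion\<close>

lemma ball_basis_iff:
  assumes "T \<subseteq> X"
  shows "y \<in> ball_basis X \<delta> \<beta> T k \<longleftrightarrow>
    y \<in> T \<and> \<delta> (\<beta> (fst (prod_decode k))) y < 1 / 2 ^ snd (prod_decode k)"
  using assms by (auto simp: ball_basis_def qball_def split_beta)

lemma ball_basis_total:
  assumes "T \<subseteq> X"
  shows "total_basis_numbering (subtopology (qtopology X \<delta>) T) (ball_basis X \<delta> \<beta> T)"
  unfolding total_basis_numbering_def
proof (intro ext iffI)
  fix U assume "openin (subtopology (qtopology X \<delta>) T) U"
  then obtain V where V: "openin (qtopology X \<delta>) V" "U = V \<inter> T"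
    unfolding openin_subtopology by blast
  have "\<exists>k. y \<in> ball_basis X \<delta> \<beta> T k \<and> ball_basis X \<delta> \<beta> T k \<subseteq> U" if "y \<in> U" for y
  proof -
    have y: "y \<in> X" "y \<in> V" "y \<in> T" using that V assms by auto
    obtain r where r: "r > 0" "qball X \<delta> y r \<subseteq> V" using qball_subset[OF V(1) y(2)] by blast
    then obtain e where "(1 / 2) ^ e < r / 2"
      using real_arch_pow_inv[of "r / 2" "1 / 2"] by auto
    then have e: "1 / 2 ^ e < r / 2" by (simp add: power_one_over)
    \<comment> \<open>The first inequality puts \<open>y\<close> into the ball
      \<open>(a, e)\<close>; the second, with the triangle inequality through the centre, keeps that
      ball inside \<open>qball X \<delta> y r\<close>.\<close>
    obtain a where a: "\<delta> (\<beta> a) y < 1 / 2 ^ e" "\<delta> y (\<beta> a) < 1 / 2 ^ e"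
      using dense[OF y(1), of "1 / 2 ^ e"] by auto
    have "ball_basis X \<delta> \<beta> T (pair a e) \<subseteq> U"
    proof
      fix z assume z: "z \<in> ball_basis X \<delta> \<beta> T (pair a e)"
      then have "z \<in> T" "\<delta> (\<beta> a) z < 1 / 2 ^ e" by (auto simp: ball_basis_iff[OF assms])
      then have "z \<in> qball X \<delta> y r"
        using triangle[OF y(1) \<beta>_in, of z a] a e assms by (auto simp: qball_def)
      then show "z \<in> U" using r \<open>z \<in> T\<close> V by blast
    qed
    then show ?thesis using a y by (intro exI[of _ "pair a e"]) (auto simp: ball_basis_iff[OF assms])
  qed
  then show "(arbitrary union_of (\<lambda>U. U \<in> range (ball_basis X \<delta> \<beta> T))) U"
    unfolding arbitrary_union_of_alt by blast
next
  fix U assume "(arbitrary union_of (\<lambda>U. U \<in> range (ball_basis X \<delta> \<beta> T))) U"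
  then obtain \<U> where U: "\<U> \<subseteq> range (ball_basis X \<delta> \<beta> T)" "\<Union>\<U> = U"
    unfolding union_of_def by auto
  have "openin (subtopology (qtopology X \<delta>) T) (ball_basis X \<delta> \<beta> T k)" for k
    unfolding ball_basis_def split_beta
    by (intro openin_subtopology_Int openin_qball \<beta>_in) simp
  then show "openin (subtopology (qtopology X \<delta>) T) U"
    using U by blast
qed

lemma ball_prec_iff:
  "ball_prec \<delta> \<beta> k l \<longleftrightarrow>
     \<delta> (\<beta> (fst (prod_decode l))) (\<beta> (fst (prod_decode k))) + 1 / 2 ^ snd (prod_decode k)
       < 1 / 2 ^ snd (prod_decode l)"
  by (auto simp: ball_prec_def split_beta)

lemma ball_prec_imp_subset:
  assumes "T \<subseteq> X" and "ball_prec \<delta> \<beta> k l"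
  shows "ball_basis X \<delta> \<beta> T k \<subseteq> ball_basis X \<delta> \<beta> T l"
proof
  fix z assume "z \<in> ball_basis X \<delta> \<beta> T k"
  then show "z \<in> ball_basis X \<delta> \<beta> T l"
    using triangle[OF \<beta>_in \<beta>_in, of z "fst (prod_decode l)" "fst (prod_decode k)"] assms
    by (auto simp: ball_basis_iff ball_prec_iff)
qed

lemma ball_strong_inclusion:
  assumes "T \<subseteq> X"
  shows "strong_inclusion (ball_basis X \<delta> \<beta> T) (ball_prec \<delta> \<beta>)"
  unfolding strong_inclusion_def
proof (intro conjI transpI allI impI)
  fix k l m assume "ball_prec \<delta> \<beta> k l" "ball_prec \<delta> \<beta> l m"
  then show "ball_prec \<delta> \<beta> k m"
    unfolding ball_prec_iff
    using triangle[OF \<beta>_in \<beta>_in \<beta>_in,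
        of "fst (prod_decode m)" "fst (prod_decode k)" "fst (prod_decode l)"]
    by linarith
qed (rule ball_prec_imp_subset[OF assms])

text \<open>One half of the gap \<open>g\<close> absorbs \<open>\<delta> y (\<beta> a)\<close>, the
  other half the radius of the small ball. As the conclusion holds for all large \<open>e\<close>,
  one radius can serve several given balls.\<close>

lemma ball_prec_of_small:
  assumes "y \<in> X" and "\<delta> (\<beta> (fst (prod_decode m))) y < 1 / 2 ^ snd (prod_decode m)"
  shows "\<exists>d. \<forall>e\<ge>d. \<forall>a. \<delta> y (\<beta> a) < 1 / 2 ^ e \<longrightarrow> ball_prec \<delta> \<beta> (pair a e) m"
proof -
  define g where "g = 1 / 2 ^ snd (prod_decode m) - \<delta> (\<beta> (fst (prod_decode m))) y"
  have "g > 0" using assms(2) by (simp add: g_def)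
  then obtain d where "(1 / 2) ^ d < g / 2"
    using real_arch_pow_inv[of "g / 2" "1 / 2"] by auto
  then have d: "1 / 2 ^ d < g / 2" by (simp add: power_one_over)
  have "ball_prec \<delta> \<beta> (pair a e) m" if "d \<le> e" "\<delta> y (\<beta> a) < 1 / 2 ^ e" for a e
  proof -
    have "1 / 2 ^ e \<le> (1 / 2 ^ d :: real)" using that(1) by (simp add: frac_le)
    then show ?thesis
      unfolding ball_prec_iff
      using triangle[OF \<beta>_in assms(1) \<beta>_in, of "fst (prod_decode m)" a] that(2) d g_def by simp
  qed
  then show ?thesis by blast
qed

text \<open>When \<open>k\<close> has a larger radius than \<open>l\<close>, truncated subtraction makes the numerator \<open>0\<close>,
  so both sides are false.\<close>

lemma ball_prec_iff_quadruple:
  "ball_prec \<delta> \<beta> k l \<longleftrightarrow>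
     quadruple (fst (prod_decode l)) (fst (prod_decode k))
       (2 ^ (snd (prod_decode k) - snd (prod_decode l)) - 1) (snd (prod_decode k))
     \<in> {quadruple a b c e | a b c e. \<delta> (\<beta> a) (\<beta> b) < real c / 2 ^ e}"
proof -
  obtain i m j n where k: "prod_decode k = (i, m)" and l: "prod_decode l = (j, n)" by fastforce
  have pos: "0 \<le> \<delta> (\<beta> j) (\<beta> i)" by (intro nonneg \<beta>_in)
  have "\<delta> (\<beta> j) (\<beta> i) + 1 / 2 ^ m < 1 / 2 ^ n
      \<longleftrightarrow> \<delta> (\<beta> j) (\<beta> i) < real (2 ^ (m - n) - 1) / 2 ^ m"
  proof (cases "n \<le> m")
    case True
    have "real (2 ^ (m - n) - 1) = 2 ^ (m - n) - 1" by (simp add: of_nat_diff)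
    moreover have "(2 ^ (m - n) :: real) = 2 ^ m / 2 ^ n" using True by (simp add: power_diff)
    ultimately have "real (2 ^ (m - n) - 1) / 2 ^ m = 1 / 2 ^ n - 1 / 2 ^ m"
      by (simp add: diff_divide_distrib)
    then show ?thesis by linarith
  next
    case False
    then have "1 / 2 ^ n \<le> (1 / 2 ^ m :: real)" by (simp add: frac_le)
    then show ?thesis using pos False by simp
  qed
  then show ?thesis by (simp add: ball_prec_def k l)
qed

text \<open>Strong inclusion compares a distance of centres with a difference of two dyadic radii,
  so it is read off the c.e. set of upper estimates.\<close>

lemma semidecidable_ball_prec:
  assumes "computable_quasi_metric \<delta> \<beta>" and "computable n a" and "computable n b"
  shows "semidecidable n (\<lambda>xs. ball_prec \<delta> \<beta> (a xs) (b xs))"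
  unfolding ball_prec_iff_quadruple
  using assms(1) unfolding computable_quasi_metric_def
  by (intro semidecidable_ce_set computable_intros assms(2,3)) auto

end

section \<open>Effectivity and effective regularity of the ball bases\<close>

context dense_quasi_metric_space
begin

text \<open>The assumption on \<open>W \<phi> i\<close> speaks only of diagonal triples, where it is
  symmetric in the two directions; thus the same numbering \<open>x\<close> serves the distance and
  its conjugate.\<close>

lemma effective_space_ball_basis:
  assumes "goedel_numbering \<phi>" and "computable_quasi_metric \<delta> \<beta>"
    and "T \<subseteq> X" and "ran x = T"
    and W: "\<And>i y a e. x i = Some y \<Longrightarrow>
      triple a a e \<in> W \<phi> i \<longleftrightarrow> \<delta> (\<beta> a) y < 1 / 2 ^ e \<and> \<delta> y (\<beta> a) < 1 / 2 ^ e"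
  shows "effective_space (subtopology (qtopology X \<delta>) T) x (ball_basis X \<delta> \<beta> T) (ball_prec \<delta> \<beta>)"
proof -
  \<comment> \<open>Argument 0 is the code of the ball to be found; the others are the inputs
    \<open>i\<close>, \<open>m\<close>, \<open>n\<close> of \<open>sb\<close>.\<close>
  define P where "P xs \<longleftrightarrow>
      triple (fst (prod_decode (xs ! 0))) (fst (prod_decode (xs ! 0))) (snd (prod_decode (xs ! 0)))
        \<in> W \<phi> (xs ! 1)
      \<and> ball_prec \<delta> \<beta> (xs ! 0) (xs ! 2) \<and> ball_prec \<delta> \<beta> (xs ! 0) (xs ! 3)" for xs
  have "semidecidable (Suc 3) P"
    unfolding P_def
    by (intro semidecidable_conj semidecidable_W semidecidable_ball_prec assms(1,2)
        computable_intros) auto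
  then obtain f where f: "partial_computable 3 f"
    and f_sel: "\<And>xs. length xs = 3 \<Longrightarrow> \<exists>k. P (k # xs) \<Longrightarrow> \<exists>k. f xs = Some k \<and> P (k # xs)"
    using semidecidable_selection by blast
  have "partial_computable3 (\<lambda>i m n. f [i, m, n])"
  proof -
    have "f [xs ! 0, xs ! 1, xs ! 2] = f xs" if "length xs = 3" for xs
      using that by (auto simp: length_Suc_conv numeral_3_eq_3)
    with f show ?thesis
      unfolding partial_computable3_def partial_computable_def by auto
  qed
  moreover have "\<exists>k. f [i, m, n] = Some k \<and> y \<in> ball_basis X \<delta> \<beta> T k
      \<and> ball_prec \<delta> \<beta> k m \<and> ball_prec \<delta> \<beta> k n"
    if x: "x i = Some y" and y: "y \<in> ball_basis X \<delta> \<beta> T m \<inter> ball_basis X \<delta> \<beta> T n" for i y m n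
  proof -
    have yT: "y \<in> T" and yX: "y \<in> X" using y assms(3) by (auto simp: ball_basis_iff)
    obtain d where d: "\<And>a e. d \<le> e \<Longrightarrow> \<delta> y (\<beta> a) < 1 / 2 ^ e \<Longrightarrow> ball_prec \<delta> \<beta> (pair a e) m"
      using ball_prec_of_small[OF yX, of m] y by (auto simp: ball_basis_iff[OF assms(3)])
    obtain d' where d': "\<And>a e. d' \<le> e \<Longrightarrow> \<delta> y (\<beta> a) < 1 / 2 ^ e \<Longrightarrow> ball_prec \<delta> \<beta> (pair a e) n"
      using ball_prec_of_small[OF yX, of n] y by (auto simp: ball_basis_iff[OF assms(3)])
    define e where "e = max d d'"
    obtain a where a: "\<delta> (\<beta> a) y < 1 / 2 ^ e" "\<delta> y (\<beta> a) < 1 / 2 ^ e"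
      using dense[OF yX, of "1 / 2 ^ e"] by auto
    \<comment> \<open>This guarantees that the search succeeds. The ball \<open>k\<close> that it
      finds may be another one, but \<open>P\<close> alone gives it the required properties.\<close>
    have "P [pair a e, i, m, n]"
      using d[of e a] d'[of e a] a by (simp add: P_def W[OF x] e_def eval_nat_numeral)
    then obtain k where "f [i, m, n] = Some k" "P [k, i, m, n]"
      using f_sel[of "[i, m, n]"] by auto
    then show ?thesis
      using yT by (auto simp: P_def W[OF x] ball_basis_iff[OF assms(3)] eval_nat_numeral)
  qed
  moreover have "topspace (subtopology (qtopology X \<delta>) T) = T"
    using assms(3) by (auto simp: topspace_qtopology)
  ultimately show ?thesis
    unfolding effective_space_def numbering_of_def
    using ball_basis_total[OF assms(3)] ball_strong_inclusion[OF assms(3)] assms(4)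
    by (intro conjI exI[of _ "\<lambda>i m n. f [i, m, n]"]) auto
qed

text \<open>The complement of \<open>B\<^sub>m\<close> is covered by the conjugate balls \<open>(b, q)\<close> with
  \<open>\<delta> \<beta>\<^sub>a \<beta>\<^sub>b > 2\<^sup>-\<^sup>r + 2\<^sup>-\<^sup>q\<close>, where \<open>(a, r)\<close> is a ball around the point that is strongly included
  in \<open>B\<^sub>m\<close>; by the triangle inequality those balls are disjoint from the ball \<open>(a, r)\<close>.\<close>

lemma effectively_regular_wrt_conj_dist:
  assumes "goedel_numbering \<phi>" and "computable_quasi_metric \<delta> \<beta>" and "T \<subseteq> X"
    and W: "\<And>i y a e. x i = Some y \<Longrightarrow>
      triple a a e \<in> W \<phi> i \<longleftrightarrow> \<delta> (\<beta> a) y < 1 / 2 ^ e \<and> \<delta> y (\<beta> a) < 1 / 2 ^ e"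
  shows "effectively_regular_wrt \<phi> T x (ball_basis X \<delta> \<beta> T) (ball_basis X (conj_dist \<delta>) \<beta> T)"
proof -
  interpret c: dense_quasi_metric_space X "conj_dist \<delta>" \<beta>
    by (rule conj_dist_dense_quasi_metric_space)
  define P where "P xs \<longleftrightarrow>
      triple (fst (prod_decode (xs ! 0))) (fst (prod_decode (xs ! 0))) (snd (prod_decode (xs ! 0)))
        \<in> W \<phi> (xs ! 1)
      \<and> ball_prec \<delta> \<beta> (xs ! 0) (xs ! 2)" for xs
  have "semidecidable (Suc 2) P"
    unfolding P_def
    by (intro semidecidable_conj semidecidable_W semidecidable_ball_prec assms(1,2)
        computable_intros) auto
  then obtain s where s: "partial_computable 2 s"
    and s_sel: "\<And>xs. length xs = 2 \<Longrightarrow> \<exists>k. P (k # xs) \<Longrightarrow> \<exists>k. s xs = Some k \<and> P (k # xs)"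
    using semidecidable_selection by blast
  define far where "far k l \<longleftrightarrow>
      \<delta> (\<beta> (fst (prod_decode k))) (\<beta> (fst (prod_decode l)))
        > 1 / 2 ^ snd (prod_decode k) + 1 / 2 ^ snd (prod_decode l)" for k l
  \<comment> \<open>The two radii are added over the product of their denominators, which makes
    \<open>far\<close> an instance of the c.e. lower estimates of distances.\<close>
  have "far k l \<longleftrightarrow> quadruple (fst (prod_decode k)) (fst (prod_decode l))
        (2 ^ snd (prod_decode l) + 2 ^ snd (prod_decode k))
        (snd (prod_decode k) + snd (prod_decode l))
      \<in> {quadruple a b c e | a b c e. \<delta> (\<beta> a) (\<beta> b) > real c / 2 ^ e}" for k l
    by (simp add: far_def power_add add_divide_distrib)
  moreover have "semidecidable 2 (\<lambda>xs.
      quadruple (fst (prod_decode (xs ! 0))) (fst (prod_decode (xs ! 1)))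
        (2 ^ snd (prod_decode (xs ! 1)) + 2 ^ snd (prod_decode (xs ! 0)))
        (snd (prod_decode (xs ! 0)) + snd (prod_decode (xs ! 1)))
      \<in> {quadruple a b c e | a b c e. \<delta> (\<beta> a) (\<beta> b) > real c / 2 ^ e})"
    using assms(2) unfolding computable_quasi_metric_def
    by (intro semidecidable_ce_set computable_intros) auto
  ultimately have "semidecidable 2 (\<lambda>xs. far (xs ! 0) (xs ! 1))" by simp
  then obtain h where h: "computable 1 (\<lambda>xs. h (xs ! 0))" and W_h: "\<And>k. W \<phi> (h k) = {l. far k l}"
    using uniform_index[OF assms(1), of far] by blast
  have list2: "[xs ! 0, xs ! 1] = xs" if "length xs = 2" for xs :: "nat list"
    using that by (auto simp: length_Suc_conv numeral_2_eq_2)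
  have "partial_computable2 (\<lambda>i m. s [i, m])"
    using s list2 unfolding partial_computable2_def partial_computable_def by auto
  \<comment> \<open>The function \<open>t\<close> is \<open>h\<close> after \<open>s\<close>, so it
    lists the exterior of the very ball that \<open>s\<close> found.\<close>
  moreover have "partial_computable2 (\<lambda>i m. map_option h (s [i, m]))"
    using partial_computable_map_option[OF s h] list2
    unfolding partial_computable2_def partial_computable_def by auto
  moreover have "\<exists>k l. s [i, m] = Some k \<and> map_option h (s [i, m]) = Some l
      \<and> y \<in> ball_basis X \<delta> \<beta> T k \<and> ball_basis X \<delta> \<beta> T k \<subseteq> ball_basis X \<delta> \<beta> T m
      \<and> T - ball_basis X \<delta> \<beta> T m \<subseteq> lacombe \<phi> (ball_basis X (conj_dist \<delta>) \<beta> T) l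
      \<and> ball_basis X \<delta> \<beta> T k \<inter> lacombe \<phi> (ball_basis X (conj_dist \<delta>) \<beta> T) l = {}"
    if x: "x i = Some y" and y: "y \<in> ball_basis X \<delta> \<beta> T m" for i y m
  proof -
    have yT: "y \<in> T" and yX: "y \<in> X" using y assms(3) by (auto simp: ball_basis_iff)
    obtain e where e: "\<And>a. \<delta> y (\<beta> a) < 1 / 2 ^ e \<Longrightarrow> ball_prec \<delta> \<beta> (pair a e) m"
      using ball_prec_of_small[OF yX, of m] y by (auto simp: ball_basis_iff[OF assms(3)])
    obtain a where a: "\<delta> (\<beta> a) y < 1 / 2 ^ e" "\<delta> y (\<beta> a) < 1 / 2 ^ e"
      using dense[OF yX, of "1 / 2 ^ e"] by auto
    have "P [pair a e, i, m]"
      using e[of a] a by (simp add: P_def W[OF x] eval_nat_numeral)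
    then obtain k where k: "s [i, m] = Some k" "P [k, i, m]"
      using s_sel[of "[i, m]"] by auto
    obtain b r where br: "prod_decode k = (b, r)" by fastforce
    have k_y: "y \<in> ball_basis X \<delta> \<beta> T k" and k_prec: "ball_prec \<delta> \<beta> k m"
      using k(2) yT by (auto simp: P_def W[OF x] ball_basis_iff[OF assms(3)] eval_nat_numeral)
    have cover: "T - ball_basis X \<delta> \<beta> T m \<subseteq> lacombe \<phi> (ball_basis X (conj_dist \<delta>) \<beta> T) (h k)"
    proof
      fix z assume "z \<in> T - ball_basis X \<delta> \<beta> T m"
      then have z: "z \<in> T" "z \<in> X"
        and "\<delta> (\<beta> (fst (prod_decode m))) z \<ge> 1 / 2 ^ snd (prod_decode m)"
        using assms(3) by (auto simp: ball_basis_iff)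
      \<comment> \<open>If \<open>\<delta> (\<beta> b) z\<close> were at most
        \<open>1 / 2 ^ r\<close>, strong inclusion and the triangle inequality through
        \<open>\<beta> b\<close> would put \<open>z\<close> into the ball \<open>m\<close>.\<close>
      then have "0 < \<delta> (\<beta> b) z - 1 / 2 ^ r"
        using k_prec triangle[OF \<beta>_in \<beta>_in z(2), of "fst (prod_decode m)" b]
        by (simp add: ball_prec_iff br)
      then obtain q where "(1 / 2) ^ q < (\<delta> (\<beta> b) z - 1 / 2 ^ r) / 2"
        using real_arch_pow_inv[of "(\<delta> (\<beta> b) z - 1 / 2 ^ r) / 2" "1 / 2"] by auto
      then have q: "1 / 2 ^ q < (\<delta> (\<beta> b) z - 1 / 2 ^ r) / 2" by (simp add: power_one_over)
      \<comment> \<open>The first inequality gives \<open>far\<close>, since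
        \<open>\<delta> (\<beta> b) (\<beta> d)\<close> exceeds
        \<open>\<delta> (\<beta> b) z - 1 / 2 ^ q\<close>; the second is membership of
        \<open>z\<close> in the conjugate ball.\<close>
      obtain d where d: "\<delta> (\<beta> d) z < 1 / 2 ^ q" "\<delta> z (\<beta> d) < 1 / 2 ^ q"
        using dense[OF z(2), of "1 / 2 ^ q"] by auto
      have "far k (pair d q)"
        using q d triangle[OF \<beta>_in \<beta>_in z(2), of b d] by (simp add: far_def br)
      moreover have "z \<in> ball_basis X (conj_dist \<delta>) \<beta> T (pair d q)"
        using d z by (simp add: c.ball_basis_iff[OF assms(3)] conj_dist_def)
      ultimately show "z \<in> lacombe \<phi> (ball_basis X (conj_dist \<delta>) \<beta> T) (h k)"
        unfolding lacombe_def W_h by blast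
    qed
    \<comment> \<open>A common point would bound the distance of the centres by the sum of the
      radii: the ball \<open>k\<close> controls the way to \<open>z\<close>, the conjugate ball the
      way from \<open>z\<close>.\<close>
    have "z \<notin> ball_basis X (conj_dist \<delta>) \<beta> T l" if "z \<in> ball_basis X \<delta> \<beta> T k" "far k l" for z l
      using that triangle[OF \<beta>_in _ \<beta>_in, of z "fst (prod_decode k)" "fst (prod_decode l)"] assms(3)
      by (auto simp: far_def ball_basis_iff c.ball_basis_iff conj_dist_def)
    then have "ball_basis X \<delta> \<beta> T k \<inter> lacombe \<phi> (ball_basis X (conj_dist \<delta>) \<beta> T) (h k) = {}"
      unfolding lacombe_def W_h by blast
    then show ?thesis
      using k(1) k_y cover ball_prec_imp_subset[OF assms(3) k_prec] by simp
  qed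
  ultimately show ?thesis
    unfolding effectively_regular_wrt_def
    by (intro exI[of _ "\<lambda>i m. s [i, m]"] exI[of _ "\<lambda>i m. map_option h (s [i, m])"]) auto
qed

end

section \<open>Passing to the conjugate distance\<close>

lemma conj_dist_conj_dist [simp]: "conj_dist (conj_dist \<delta>) = \<delta>"
  by (simp add: conj_dist_def fun_eq_iff)

text \<open>Exchanging the two centres in a code is a computable involution, and the sets for the
  conjugate are preimages of c.e. sets under it.\<close>

lemma computable_quasi_metric_conj_dist:
  assumes "computable_quasi_metric \<delta> \<beta>"
  shows "computable_quasi_metric (conj_dist \<delta>) \<beta>"
proof -
  define swap where "swap q = quadruple
      (snd (prod_decode (fst (prod_decode (fst (prod_decode q))))))
      (fst (prod_decode (fst (prod_decode (fst (prod_decode q))))))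
      (snd (prod_decode (fst (prod_decode q)))) (snd (prod_decode q))" for q
  have swap: "swap (quadruple a b c e) = quadruple b a c e" for a b c e
    by (simp add: swap_def)
  have inv: "swap (swap q) = q" for q by (simp add: swap_def)
  have vimage: "{quadruple a b c e | a b c e. R b a c e} = swap -` {quadruple a b c e | a b c e. R a b c e}"
    for R
  proof (intro equalityI subsetI)
    fix q assume "q \<in> swap -` {quadruple a b c e | a b c e. R a b c e}"
    then obtain a b c e where "swap q = quadruple a b c e" "R a b c e" by auto
    then show "q \<in> {quadruple a b c e | a b c e. R b a c e}"
      using inv[of q] swap by fastforce
  qed (auto simp: swap)
  have "computable 1 (\<lambda>xs. swap (xs ! 0))"
    unfolding swap_def by (intro computable_intros) simp_all
  then show ?thesis
    using assms ce_set_vimage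
    unfolding computable_quasi_metric_def conj_dist_def
      vimage[of "\<lambda>a b c e. \<delta> (\<beta> a) (\<beta> b) < real c / 2 ^ e"]
      vimage[of "\<lambda>a b c e. \<delta> (\<beta> a) (\<beta> b) > real c / 2 ^ e"]
    by blast
qed

theorem theorem5p6:
  fixes X Q :: "'a set" and \<delta> :: "'a \<Rightarrow> 'a \<Rightarrow> real" and \<beta> :: "nat \<Rightarrow> 'a"
    and \<phi> :: "nat \<Rightarrow> nat \<Rightarrow> nat option"
  assumes "goedel_numbering \<phi>"
    and "quasi_metric_space X \<delta>"
    and "Q \<subseteq> X" and "countable Q"
    and "qtopology X (sym_dist \<delta>) closure_of Q = X"
    and "range \<beta> = Q"
    and "computable_quasi_metric \<delta> \<beta>"
  defines "Xc \<equiv> computable_points X \<delta> \<beta>"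
    and "\<delta>c \<equiv> conj_dist \<delta>"
    and "xc \<equiv> point_numbering \<phi> X \<delta> \<beta>"
  shows "bi_effective_space
           (subtopology (qtopology X \<delta>) Xc) (subtopology (qtopology X \<delta>c) Xc) xc
           (ball_basis X \<delta> \<beta> Xc) (ball_prec \<delta> \<beta>)
           (ball_basis X \<delta>c \<beta> Xc) (ball_prec \<delta>c \<beta>)
       \<and> effectively_pairwise_regular \<phi> Xc xc (ball_basis X \<delta> \<beta> Xc) (ball_basis X \<delta>c \<beta> Xc)"
proof -
  interpret quasi_metric_space X \<delta> by fact
  interpret dense_quasi_metric_space X \<delta> \<beta>
  proof
    show "\<beta> a \<in> X" for a using assms(3,6) by blast
    fix y and \<epsilon> :: real assume y: "y \<in> X" and \<epsilon>: "0 < \<epsilon>"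
    \<comment> \<open>A point of the closure has an element of \<open>Q\<close> in every open set
      around it; for a ball of the symmetrised distance, that element is close in both
      directions.\<close>
    have "openin (qtopology X (sym_dist \<delta>)) (qball X (sym_dist \<delta>) y \<epsilon>)"
      unfolding qtopology_def by (rule topology_generated_by_Basis) (use y \<epsilon> in blast)
    moreover have "y \<in> qball X (sym_dist \<delta>) y \<epsilon>"
      using y \<epsilon> refl by (simp add: qball_def sym_dist_def conj_dist_def)
    moreover have "y \<in> qtopology X (sym_dist \<delta>) closure_of Q" using y assms(5) by simp
    ultimately obtain z where "z \<in> Q" "z \<in> qball X (sym_dist \<delta>) y \<epsilon>"
      unfolding in_closure_of by blast
    then show "\<exists>a. \<delta> (\<beta> a) y < \<epsilon> \<and> \<delta> y (\<beta> a) < \<epsilon>"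
      using assms(6) by (auto simp: qball_def sym_dist_def conj_dist_def)
  qed
  interpret c: dense_quasi_metric_space X \<delta>c \<beta>
    unfolding \<delta>c_def by (rule conj_dist_dense_quasi_metric_space)
  have sub: "Xc \<subseteq> X" by (auto simp: Xc_def computable_points_def)
  have ran: "ran xc = Xc" unfolding xc_def Xc_def by (rule ran_point_numbering) fact
  have comp: "computable_quasi_metric \<delta>c \<beta>"
    unfolding \<delta>c_def by (rule computable_quasi_metric_conj_dist) fact
  have W: "triple a a e \<in> W \<phi> i \<longleftrightarrow> \<delta> (\<beta> a) y < 1 / 2 ^ e \<and> \<delta> y (\<beta> a) < 1 / 2 ^ e"
    if "xc i = Some y" for i y a e
    using that by (auto simp: xc_def point_numbering_eq_Some_iff approximations_def)
  \<comment> \<open>\<open>W \<phi> i\<close> still lists approximations with respect to \<delta>;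
    for the conjugate the two centres trade places, which changes nothing on the diagonal.\<close>
  have Wc: "triple a a e \<in> W \<phi> i \<longleftrightarrow> \<delta>c (\<beta> a) y < 1 / 2 ^ e \<and> \<delta>c y (\<beta> a) < 1 / 2 ^ e"
    if "xc i = Some y" for i y a e
    using W[OF that] by (auto simp: \<delta>c_def conj_dist_def)
  \<comment> \<open>This instance ends in \<open>conj_dist \<delta>c\<close>, which the final
    simplification turns back into \<delta>.\<close>
  have "effectively_regular_wrt \<phi> Xc xc (ball_basis X \<delta>c \<beta> Xc) (ball_basis X (conj_dist \<delta>c) \<beta> Xc)"
    by (rule c.effectively_regular_wrt_conj_dist[OF assms(1) comp sub Wc])
  moreover have "effectively_regular_wrt \<phi> Xc xc (ball_basis X \<delta> \<beta> Xc) (ball_basis X \<delta>c \<beta> Xc)"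
    unfolding \<delta>c_def by (rule effectively_regular_wrt_conj_dist[OF assms(1,7) sub W])
  moreover have "topspace (subtopology (qtopology X \<delta>) Xc) = topspace (subtopology (qtopology X \<delta>c) Xc)"
    by (simp add: topspace_qtopology c.topspace_qtopology)
  ultimately show ?thesis
    unfolding bi_effective_space_def effectively_pairwise_regular_def
    using effective_space_ball_basis[OF assms(1,7) sub ran W]
      c.effective_space_ball_basis[OF assms(1) comp sub ran Wc]
    by (simp add: \<delta>c_def)
qed

end
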